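(* For every positive integer $k$ there exist constants $C_k\geq 1$ and $A_k>0$, depending only on $k$, such that the following holds. For every positive integer $d$, all real numbers $\alpha_1,\dots,\alpha_d$, and every integer $N\geq1$, there exists an integer $1\leq n\leq N$ such that \[\|n^k\alpha_j\|\leq A_k \exp\bigl(-(C_k d^{5})^{-1}(\log N)^{1/C_k}\bigr)\quad\text{for } j=1,\dots,d.\]
   Context: For $\alpha\in\mathbb R$, $\|\alpha\|$ denotes the distance from $\alpha$ to the nearest integer. *)

theory Defs
  imports Complex_Main
begin

definition dist_int :: "real \<Rightarrow> real" where
  "dist_int x = (INF m\<in>(\<int>::real set). \<bar>x - m\<bar>)"

end

theory Submission
  imports Defs "HOL-Analysis.Kronecker_Approximation_Theorem" "Jordan_Normal_Form.Determinant"
begin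

unbundle no vec_syntax

text \<open>
  Average the kernel \<open>K(x) = \<Prod>\<^sub>j cos(\<pi> x\<^sub>j)\<^bsup>2m\<^esup>\<close>, a trigonometric polynomial with positive coefficients and
  integer frequencies \<open>h\<close> of size at most \<open>m\<close>, over the points \<open>n\<^sup>k \<alpha>\<close>. Unless some point is close to \<open>0\<close>,
  a frequency \<open>h \<noteq> 0\<close> has a large Weyl sum, and Weyl's inequality, with losses polynomial in the
  reciprocal of the normalised sum, shows that \<open>q h \<cdot> \<alpha>\<close> is very close to an integer for some small \<open>q\<close>. Restrict \<open>n\<close> to
  multiples of \<open>q\<close> and repeat. The frequencies in the rational span of those already found are made harmless by restricting \<open>n\<close>
  further to multiples of a determinant, so each round produces a frequency linearly independent of the
  previous ones, and the process stops after at most \<open>d\<close> rounds. Every round costs a factor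
  \<open>G = exp(O\<^sub>k(d\<^sup>2 L))\<close> in the length of the range of \<open>n\<close>, where \<open>exp(-L)\<close> is the desired accuracy; hence
  \<open>log N \<ge> C d\<^sup>3 L\<close> suffices.
\<close>

section \<open>Recurrence of dense sets of multiples\<close>

lemma dist_int_le: "dist_int x \<le> \<bar>x - of_int p\<bar>"
  unfolding dist_int_def by (rule cINF_lower) (auto intro: bdd_belowI[of _ 0])

lemma dist_int_attained:
  obtains p :: int where "dist_int x = \<bar>x - of_int p\<bar>"
proof -
  have "\<bar>x - of_int (round x)\<bar> \<le> dist_int x"
    unfolding dist_int_def
  proof (rule cINF_greatest)
    fix m :: real assume "m \<in> \<int>"
    then show "\<bar>x - of_int (round x)\<bar> \<le> \<bar>x - m\<bar>"
      using round_diff_minimal[of x] by (auto elim!: Ints_cases)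
  qed auto
  then show thesis
    using that[of "round x"] dist_int_le[of x "round x"] by simp
qed

lemma dist_int_nonneg: "dist_int x \<ge> 0"
  by (rule dist_int_attained[of x]) simp

lemma dist_int_le_half: "dist_int x \<le> 1 / 2"
  using dist_int_le[of x "round x"] of_int_round_abs_le[of x] by (simp add: abs_minus_commute)

lemma dist_int_add: "dist_int (x + y) \<le> dist_int x + dist_int y"
proof -
  obtain p q :: int where "dist_int x = \<bar>x - of_int p\<bar>" "dist_int y = \<bar>y - of_int q\<bar>"
    by (meson dist_int_attained)
  then show ?thesis using dist_int_le[of "x + y" "p + q"] by simp
qed

lemma dist_int_mult_int: "dist_int (of_int n * x) \<le> \<bar>of_int n\<bar> * dist_int x"
proof -
  obtain p :: int where "dist_int x = \<bar>x - of_int p\<bar>"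
    by (meson dist_int_attained)
  moreover have "\<bar>of_int n * x - of_int (n * p)\<bar> = \<bar>of_int n\<bar> * \<bar>x - of_int p\<bar>"
    by (simp add: algebra_simps flip: abs_mult)
  ultimately show ?thesis using dist_int_le[of "of_int n * x" "n * p"] by simp
qed

lemma dist_int_mult_nat: "dist_int (real n * x) \<le> real n * dist_int x"
  using dist_int_mult_int[of "int n" x] by simp

lemma dist_int_diff: "dist_int (x - y) \<le> dist_int x + dist_int y"
  using dist_int_add[of x "-y"] dist_int_mult_int[of "-1" y] by simp

lemma dist_int_sum: "dist_int (\<Sum>i\<in>I. f i) \<le> (\<Sum>i\<in>I. dist_int (f i))"
proof (induction I rule: infinite_finite_induct)
  case (insert i I)
  then show ?case using dist_int_add[of "f i" "sum f I"] by simp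
qed (use dist_int_le[of 0 0] in simp_all)

section \<open>From many near-integral multiples to one small denominator\<close>

lemma large_fibre:
  assumes "finite S" "finite B" "B \<noteq> {}" "f ` S \<subseteq> B"
  shows "\<exists>b\<in>B. card S \<le> card B * card {x \<in> S. f x = b}"
proof (rule ccontr)
  assume "\<not> ?thesis"
  then have less: "card B * card {x \<in> S. f x = b} < card S" if "b \<in> B" for b
    using that by (auto simp: not_le)
  have "card S = (\<Sum>b\<in>B. card {x \<in> S. f x = b})"
    using sum.group[of S B f "\<lambda>_. 1::nat"] assms by simp
  then have "card B * card S = (\<Sum>b\<in>B. card B * card {x \<in> S. f x = b})"
    by (simp add: sum_distrib_left)
  also have "\<dots> < (\<Sum>b\<in>B. card S)"
    using assms less by (intro sum_strict_mono) auto
  finally show False by simp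
qed

text \<open>If \<open>a / q\<close> is a Dirichlet approximation of \<open>\<theta>\<close>, then any two elements of \<open>T\<close>
  are congruent modulo \<open>q\<close>; hence \<open>q\<close> is small, and the extreme elements of \<open>T\<close>
  show that \<open>a / q\<close> is much closer to \<open>\<theta>\<close> than Dirichlet's theorem guarantees.\<close>

lemma recurrence_in_window:
  fixes \<theta> \<epsilon> :: real and s W K :: nat
  assumes T: "T \<subseteq> {s..<s + W}" and card: "Suc K \<le> card T" and K: "K \<ge> 1"
    and near: "\<And>h. h \<in> T \<Longrightarrow> dist_int (real h * \<theta>) \<le> \<epsilon>" and small: "8 * \<epsilon> * real W \<le> 1"
  shows "\<exists>q::nat. 1 \<le> q \<and> q * K < W \<and> dist_int (real q * \<theta>) \<le> 2 * \<epsilon> / real K"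
proof -
  have fin: "finite T" using T finite_subset by blast
  have ne: "T \<noteq> {}" using card by auto
  define h0 h1 where "h0 = Min T" and "h1 = Max T"
  have h01: "h0 \<in> T" "h1 \<in> T" and bnd: "\<And>h. h \<in> T \<Longrightarrow> h0 \<le> h \<and> h \<le> h1"
    using fin ne by (auto simp: h0_def h1_def)
  have "W > 0" using h01 T by auto
  have "\<epsilon> \<ge> 0" using near[OF h01(1)] dist_int_nonneg order_trans by blast
  \<comment> \<open>Level \<open>2 * W\<close> keeps both error terms below within 1/2:
    \<open>q * (2 * \<epsilon>)\<close> by \<open>small\<close>, and \<open>t / (2 * W)\<close>,
    strictly, because \<open>t < W\<close>.\<close>
  obtain a q where aq: "coprime a q" "0 < q" "q \<le> int (2 * W)"
      "\<bar>of_int q * \<theta> - of_int a\<bar> < 1 / real (2 * W)"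
    using Dirichlet_approx_coprime[of "2 * W" \<theta>] \<open>W > 0\<close> by auto
  have key: "\<exists>p. (int h - int h0) * a = q * p
      \<and> \<bar>of_int (int h - int h0) * \<theta> - of_int p\<bar> \<le> 2 * \<epsilon>" if h: "h \<in> T" for h
  proof -
    define t where "t = int h - int h0"
    have t: "0 \<le> t" "t < int W"
      using bnd[OF h] subsetD[OF T h] subsetD[OF T h01(1)] by (auto simp: t_def)
    have "dist_int (of_int t * \<theta>) \<le> 2 * \<epsilon>"
      using dist_int_diff[of "real h * \<theta>" "real h0 * \<theta>"] near[OF h] near[OF h01(1)]
      by (simp add: t_def algebra_simps)
    then obtain p where p: "\<bar>of_int t * \<theta> - of_int p\<bar> \<le> 2 * \<epsilon>"
      by (metis dist_int_attained)
    have "of_int q * \<bar>of_int t * \<theta> - of_int p\<bar> \<le> real (2 * W) * (2 * \<epsilon>)"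
      using p aq by (intro mult_mono) auto
    also have "\<dots> \<le> 1 / 2" using small by (simp add: mult_ac)
    finally have b1: "\<bar>of_int q * (of_int t * \<theta> - of_int p)\<bar> \<le> 1 / 2"
      using aq by (simp add: abs_mult)
    have "of_int t * \<bar>of_int q * \<theta> - of_int a\<bar> \<le> of_int t * (1 / real (2 * W))"
      using t aq by (intro mult_left_mono) auto
    also have "\<dots> < 1 / 2" using t \<open>W > 0\<close> by (simp add: field_simps)
    finally have b2: "\<bar>of_int t * (of_int q * \<theta> - of_int a)\<bar> < 1 / 2"
      using t by (simp add: abs_mult)
    \<comment> \<open>The difference of the two small quantities is an integer of absolute value
      below 1, so it vanishes.\<close>
    have "of_int q * (of_int t * \<theta> - of_int p) - of_int t * (of_int q * \<theta> - of_int a)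
        = real_of_int (t * a - q * p)"
      by (simp add: algebra_simps)
    then have "\<bar>real_of_int (t * a - q * p)\<bar> < 1"
      using b1 b2 by linarith
    then have "t * a = q * p" by linarith
    then show ?thesis using p unfolding t_def by blast
  qed
  have dvd: "q dvd int h - int h0" if "h \<in> T" for h
    using key[OF that] aq(1) by (metis coprime_commute coprime_dvd_mult_left_iff dvd_triv_left)
  define u where "u = (int h1 - int h0) div q"
  have qu: "q * u = int h1 - int h0"
    unfolding u_def using dvd[OF h01(2)] by simp
  \<comment> \<open>Dividing by \<open>q\<close> keeps the elements of \<open>T\<close> distinct, so
    \<open>u + 1 \<ge> card T \<ge> K + 1\<close>; hence \<open>K\<close> is one less than the
    cardinality.\<close>
  have "inj_on (\<lambda>h. (int h - int h0) div q) T"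
    by (intro inj_onI) (use dvd in \<open>metis add_diff_cancel_right' diff_add_cancel dvd_div_mult_self of_nat_eq_iff\<close>)
  then have "card T = card ((\<lambda>h. (int h - int h0) div q) ` T)"
    by (simp add: card_image)
  also have "\<dots> \<le> card {0..u}"
    using aq bnd by (intro card_mono) (auto simp: u_def pos_imp_zdiv_nonneg_iff intro!: zdiv_mono1)
  finally have u: "int K \<le> u" using card by simp
  then have "u > 0" using K by simp
  obtain p where p: "(int h1 - int h0) * a = q * p"
      "\<bar>of_int (int h1 - int h0) * \<theta> - of_int p\<bar> \<le> 2 * \<epsilon>"
    using key[OF h01(2)] by blast
  \<comment> \<open>The error at the endpoints is therefore exactly \<open>u\<close> times that of
    \<open>q\<close>, and dividing by \<open>u \<ge> K\<close> gives the gain over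
    Dirichlet.\<close>
  have "p = u * a" using p(1) qu aq by (metis mult.assoc mult_left_cancel less_irrefl)
  then have "of_int (int h1 - int h0) * \<theta> - of_int p = of_int u * (of_int q * \<theta> - of_int a)"
    by (simp add: algebra_simps flip: qu)
  then have "of_int u * \<bar>of_int q * \<theta> - of_int a\<bar> \<le> 2 * \<epsilon>"
    using p(2) \<open>u > 0\<close> by (simp add: abs_mult)
  then have "\<bar>of_int q * \<theta> - of_int a\<bar> \<le> 2 * \<epsilon> / of_int u"
    using \<open>u > 0\<close> by (simp add: field_simps)
  also have "\<dots> \<le> 2 * \<epsilon> / real K"
    using u K \<open>\<epsilon> \<ge> 0\<close> by (intro divide_left_mono) auto
  finally have "dist_int (of_int q * \<theta>) \<le> 2 * \<epsilon> / real K"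
    using dist_int_le order_trans by blast
  moreover have "q * int K \<le> q * u" using u aq by simp
  then have "q * int K < int W" using qu subsetD[OF T h01(1)] subsetD[OF T h01(2)] by auto
  ultimately show ?thesis
    using aq(2) by (intro exI[of _ "nat q"]) (auto simp: nat_less_iff le_nat_iff simp flip: of_nat_less_iff[where 'a=int])
qed

text \<open>Cut \<open>{..<M}\<close> into blocks of length \<open>W\<close>. By pigeonhole some
  block contains at least \<open>W / (2 * Y)\<close> elements of \<open>S\<close>, and
  \<open>recurrence_in_window\<close> applies there.\<close>

lemma recurrence_of_dense_set:
  fixes \<theta> \<epsilon> Y :: real and W M :: nat
  assumes S: "S \<subseteq> {..<M}" and card: "real M \<le> Y * real (card S)" and Y: "Y \<ge> 1"
    and W: "W \<le> M" "4 * Y \<le> real W"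
    and near: "\<And>h. h \<in> S \<Longrightarrow> dist_int (real h * \<theta>) \<le> \<epsilon>" and small: "8 * \<epsilon> * real W \<le> 1"
  shows "\<exists>q::nat. 1 \<le> q \<and> real q \<le> 4 * Y \<and> dist_int (real q * \<theta>) \<le> 8 * \<epsilon> * Y / real W"
proof -
  have "W > 0" using W Y by (cases W) auto
  have "finite S" using S finite_subset by blast
  have "(\<lambda>h. h div W) ` S \<subseteq> {..M div W}"
    using S by (auto intro!: div_le_mono)
  with \<open>finite S\<close> obtain b where "card S \<le> card {..M div W} * card {h \<in> S. h div W = b}"
    using large_fibre[of S "{..M div W}" "\<lambda>h. h div W"] by auto
  moreover define T where "T = {h \<in> S. h div W = b}"
  ultimately have le: "card S \<le> Suc (M div W) * card T" by simp
  have TS: "T \<subseteq> S" by (auto simp: T_def)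
  \<comment> \<open>The last block may be incomplete; \<open>W \<le> M\<close> limits the loss to a
    factor 2.\<close>
  have blocks: "W * Suc (M div W) \<le> 2 * M"
    unfolding mult_Suc_right using W(1) times_div_less_eq_dividend[of W M] by linarith
  have "real W * real M \<le> Y * (2 * real M * real (card T))"
  proof -
    have "real W * real M \<le> real W * (Y * real (card S))"
      using card by (intro mult_left_mono) auto
    also have "\<dots> = Y * real (W * card S)" by simp
    also have "W * card S \<le> 2 * M * card T"
      using mult_le_mono2[OF le, of W] mult_le_mono1[OF blocks, of "card T"] unfolding mult.assoc by linarith
    then have "Y * real (W * card S) \<le> Y * real (2 * M * card T)"
      using Y by (intro mult_left_mono) (auto simp del: of_nat_mult)
    finally show ?thesis by simp
  qed
  then have "real M * real W \<le> real M * (2 * Y * real (card T))"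
    by (simp add: algebra_simps)
  then have cT: "real W \<le> 2 * Y * real (card T)"
    using W \<open>W > 0\<close> by (subst (asm) mult_le_cancel_left_pos) auto
  \<comment> \<open>Two elements in the block are guaranteed by \<open>4 * Y \<le> W\<close>, so
    passing from \<open>card T\<close> to \<open>K = card T - 1\<close> costs at most another factor
    2.\<close>
  then have "2 * Y * 2 \<le> 2 * Y * real (card T)" using W by simp
  then have "card T \<ge> 2" using Y by simp
  define K where "K = card T - 1"
  have K: "K \<ge> 1" "Suc K \<le> card T" "real (card T) \<le> 2 * real K"
    using \<open>card T \<ge> 2\<close> by (auto simp: K_def)
  have "2 * Y * real (card T) \<le> 2 * Y * (2 * real K)"
    using K Y by (intro mult_left_mono) auto
  then have WK: "real W \<le> 4 * Y * real K" using cT by simp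
  have "T \<subseteq> {b * W..<b * W + W}"
    using \<open>W > 0\<close> by (auto simp: T_def dividend_less_div_times div_times_less_eq_dividend add.commute)
  then obtain q :: nat where q: "1 \<le> q" "q * K < W" "dist_int (real q * \<theta>) \<le> 2 * \<epsilon> / real K"
    using recurrence_in_window[OF _ K(2) K(1) _ small] near TS by blast
  have "real q * real K \<le> 4 * Y * real K"
    using q(2) WK by (smt (verit) of_nat_less_iff of_nat_mult)
  then have "real q \<le> 4 * Y" using K by simp
  moreover have "\<epsilon> \<ge> 0"
    using near \<open>card T \<ge> 2\<close> TS dist_int_nonneg
    by (metis card.empty equals0I not_numeral_le_zero order_trans subsetD)
  then have "2 * \<epsilon> * real W \<le> 2 * \<epsilon> * (4 * Y * real K)"
    using WK by (intro mult_left_mono) auto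
  then have "2 * \<epsilon> / real K \<le> 8 * \<epsilon> * Y / real W"
    using K \<open>W > 0\<close> by (simp add: field_simps)
  ultimately show ?thesis using q by force
qed

section \<open>Weyl's inequality with polynomial losses\<close>

definition expi :: "real \<Rightarrow> complex" where
  "expi t = cis (2 * pi * t)"

lemma norm_expi [simp]: "cmod (expi t) = 1"
  by (simp add: expi_def)

lemma expi_0 [simp]: "expi 0 = 1"
  by (simp add: expi_def)

lemma expi_add: "expi (s + t) = expi s * expi t"
  by (simp add: expi_def cis_mult algebra_simps)

lemma expi_diff: "expi (s - t) = expi s * cnj (expi t)"
  by (simp add: expi_def cis_mult cis_cnj algebra_simps)

lemma expi_of_nat_mult: "expi (real n * t) = expi t ^ n"
  by (simp add: expi_def Complex.DeMoivre mult_ac)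

lemma abs_sin_ge_dist_int: "dist_int x \<le> \<bar>sin (pi * x)\<bar>"
proof -
  \<comment> \<open>A weak form of Jordan's inequality: as \<open>t \<le> 8 / 5\<close>, the cubic
    Taylor remainder takes away at most half of \<open>t = pi * y\<close>, and the other half is at
    least \<open>y\<close>.\<close>
  have jordan: "y \<le> sin (pi * y)" if y: "0 \<le> y" "y \<le> 1 / 2" for y
  proof -
    define t where "t = pi * y"
    have t: "0 \<le> t" "t \<le> 8 / 5"
      using y pi_approx mult_mono[of pi "16 / 5" y "1 / 2"] by (auto simp: t_def)
    have "\<bar>sin t - (\<Sum>m<3. sin_coeff m * t ^ m)\<bar> \<le> inverse (fact 3) * \<bar>t\<bar> ^ 3"
      by (rule Maclaurin_sin_bound)
    then have "\<bar>sin t - t\<bar> \<le> t ^ 3 / 6"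
      using t by (simp add: sin_coeff_def numeral_eq_Suc)
    then have "t - t ^ 3 / 6 \<le> sin t" by (simp only: abs_le_iff) simp
    moreover have "t * t ^ 2 \<le> t * (8 / 5) ^ 2"
      using t by (intro mult_left_mono power_mono) auto
    then have "t ^ 3 / 6 \<le> t / 2"
      using t by (simp add: power_numeral_reduce)
    moreover have "2 * y \<le> t"
      using y pi_approx by (simp add: t_def mult_right_mono)
    ultimately show ?thesis unfolding t_def by linarith
  qed
  have abs_sin: "sin (pi * \<bar>v\<bar>) \<le> \<bar>sin (pi * v)\<bar>" for v :: real
    by (cases "v \<ge> 0") simp_all
  obtain p :: int where p: "dist_int x = \<bar>x - of_int p\<bar>"
    by (meson dist_int_attained)
  have "dist_int x \<le> sin (pi * dist_int x)"
    using jordan dist_int_nonneg dist_int_le_half by blast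
  also have "\<dots> \<le> \<bar>sin (pi * (x - of_int p))\<bar>"
    unfolding p by (rule abs_sin)
  also have "\<dots> = \<bar>sin (pi * x)\<bar>"
    by (simp add: right_diff_distrib sin_diff abs_mult cos_npi_int sin_npi_int)
  finally show ?thesis .
qed

lemma norm_expi_minus_1: "2 * dist_int t \<le> cmod (expi t - 1)"
proof -
  have "(cmod (expi t - 1))\<^sup>2 = (2 * \<bar>sin (pi * t)\<bar>)\<^sup>2"
    using cos_double_sin[of "pi * t"] sin_cos_squared_add[of "2 * pi * t"]
    unfolding cmod_power2 by (simp add: expi_def power2_eq_square algebra_simps)
  then have "cmod (expi t - 1) = 2 * \<bar>sin (pi * t)\<bar>"
    by (rule power2_eq_imp_eq) auto
  then show ?thesis using abs_sin_ge_dist_int[of t] by simp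
qed

text \<open>The identity behind Weyl differencing: expand the square, group the pairs by their
  difference \<open>h\<close>, and combine each pair with its conjugate.\<close>

lemma norm_sum_square:
  fixes w :: "nat \<Rightarrow> complex"
  shows "(cmod (\<Sum>n<L. w n))\<^sup>2 =
    (\<Sum>n<L. (cmod (w n))\<^sup>2) + 2 * Re (\<Sum>h\<in>{1..<L}. \<Sum>n<L - h. w (n + h) * cnj (w n))"
proof (induction L)
  case (Suc L)
  have "(\<Sum>h\<in>{1..<Suc L}. \<Sum>n<Suc L - h. w (n + h) * cnj (w n))
      = (\<Sum>h\<in>{1..L}. (\<Sum>n<L - h. w (n + h) * cnj (w n)) + w L * cnj (w (L - h)))"
    by (rule sum.cong) (auto simp: Suc_diff_le)
  also have "\<dots> = (\<Sum>h\<in>{1..L}. \<Sum>n<L - h. w (n + h) * cnj (w n)) + w L * (\<Sum>h\<in>{1..L}. cnj (w (L - h)))"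
    by (simp add: sum.distrib sum_distrib_left)
  also have "(\<Sum>h\<in>{1..L}. \<Sum>n<L - h. w (n + h) * cnj (w n))
      = (\<Sum>h\<in>{1..<L}. \<Sum>n<L - h. w (n + h) * cnj (w n))"
    by (rule sum.mono_neutral_right) auto
  also have "(\<Sum>h\<in>{1..L}. cnj (w (L - h))) = cnj (\<Sum>n<L. w n)"
    unfolding cnj_sum by (rule sum.reindex_bij_witness[of _ "\<lambda>n. L - n" "\<lambda>h. L - h"]) auto
  finally have *: "(\<Sum>h\<in>{1..<Suc L}. \<Sum>n<Suc L - h. w (n + h) * cnj (w n)) =
      (\<Sum>h\<in>{1..<L}. \<Sum>n<L - h. w (n + h) * cnj (w n)) + w L * cnj (\<Sum>n<L. w n)" .
  have add: "(cmod (s + v))\<^sup>2 = (cmod s)\<^sup>2 + (cmod v)\<^sup>2 + 2 * Re (v * cnj s)" for s v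
    unfolding cmod_power2 by (simp add: power2_eq_square algebra_simps)
  show ?case
    unfolding * sum.lessThan_Suc add Suc by (simp only: plus_complex.sel distrib_left ac_simps)
qed simp

text \<open>For polynomials of degree at most \<open>k\<close> this records the coefficient of
  \<open>n ^ k\<close>. Stated through differences, one Weyl step is an unfolding of the recursion,
  and lower coefficients never have to be tracked.\<close>

fun has_leading_coeff :: "nat \<Rightarrow> real \<Rightarrow> (nat \<Rightarrow> real) \<Rightarrow> bool" where
  "has_leading_coeff 0 \<theta> f \<longleftrightarrow> (\<forall>n. f n = \<theta>)"
| "has_leading_coeff (Suc k) \<theta> f \<longleftrightarrow>
    (\<forall>h. has_leading_coeff k (real (Suc k) * real h * \<theta>) (\<lambda>n. f (n + h) - f n))"

text \<open>By the binomial theorem the difference has degree at most \<open>k\<close>, and its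
  coefficient of \<open>n ^ k\<close> comes only from \<open>i = Suc k\<close>. Lower coefficients
  are arbitrary because differencing a monomial creates them.\<close>

lemma has_leading_coeff_polynomial:
  "has_leading_coeff k (a k) (\<lambda>n. \<Sum>i\<le>k. a i * real n ^ i)"
proof (induction k arbitrary: a)
  case (Suc k)
  show ?case unfolding has_leading_coeff.simps
  proof
    fix h :: nat
    define c :: "nat \<Rightarrow> nat \<Rightarrow> real"
      where "c i j = (if j < i then real (i choose j) * real h ^ (i - j) else 0)" for i j
    define a' where "a' j = (\<Sum>i\<le>Suc k. a i * c i j)" for j
    have diff: "(real (n + h)) ^ i - real n ^ i = (\<Sum>j\<le>k. c i j * real n ^ j)"
      if i: "i \<le> Suc k" for i n
    proof -
      have "(real (n + h)) ^ i = (\<Sum>j\<le>i. real (i choose j) * real n ^ j * real h ^ (i - j))"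
        by (simp add: binomial_ring)
      also have "\<dots> = (\<Sum>j<i. real (i choose j) * real n ^ j * real h ^ (i - j)) + real n ^ i"
        by (simp add: lessThan_Suc_atMost[symmetric])
      also have "(\<Sum>j<i. real (i choose j) * real n ^ j * real h ^ (i - j)) = (\<Sum>j<i. c i j * real n ^ j)"
        by (rule sum.cong) (auto simp: c_def)
      also have "\<dots> = (\<Sum>j\<le>k. c i j * real n ^ j)"
        using i by (intro sum.mono_neutral_left) (auto simp: c_def)
      finally show ?thesis by simp
    qed
    have "(\<Sum>i\<le>Suc k. a i * real (n + h) ^ i) - (\<Sum>i\<le>Suc k. a i * real n ^ i)
        = (\<Sum>j\<le>k. a' j * real n ^ j)" for n
    proof -
      have "(\<Sum>i\<le>Suc k. a i * real (n + h) ^ i) - (\<Sum>i\<le>Suc k. a i * real n ^ i)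
          = (\<Sum>i\<le>Suc k. a i * (real (n + h) ^ i - real n ^ i))"
        by (simp add: right_diff_distrib sum_subtractf)
      also have "\<dots> = (\<Sum>i\<le>Suc k. \<Sum>j\<le>k. a i * c i j * real n ^ j)"
        by (intro sum.cong refl) (simp add: diff sum_distrib_left mult.assoc del: of_nat_add)
      also have "\<dots> = (\<Sum>j\<le>k. a' j * real n ^ j)"
        unfolding a'_def sum_distrib_right by (rule sum.swap)
      finally show ?thesis .
    qed
    moreover have "a' k = real (Suc k) * real h * a (Suc k)"
      by (simp add: a'_def c_def)
    ultimately show "has_leading_coeff k (real (Suc k) * real h * a (Suc k))
        (\<lambda>n. (\<Sum>i\<le>Suc k. a i * real (n + h) ^ i) - (\<Sum>i\<le>Suc k. a i * real n ^ i))"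
      using Suc[of a'] by simp
  qed
qed simp

lemma has_leading_coeff_monomial: "has_leading_coeff k \<theta> (\<lambda>n. real n ^ k * \<theta>)"
proof -
  have "(\<Sum>i\<le>k. (if i = k then \<theta> else 0) * real n ^ i) = real n ^ k * \<theta>" for n
  proof -
    have "(\<Sum>i\<le>k. (if i = k then \<theta> else 0) * real n ^ i) = (\<Sum>i\<le>k. if i = k then real n ^ k * \<theta> else 0)"
      by (rule sum.cong) auto
    then show ?thesis by simp
  qed
  then show ?thesis
    using has_leading_coeff_polynomial[of k "\<lambda>i. if i = k then \<theta> else 0"] by simp
qed

lemma has_leading_coeff_shift:
  "has_leading_coeff k \<theta> f \<Longrightarrow> has_leading_coeff k \<theta> (\<lambda>n. f (n + s))"
proof (induction k arbitrary: \<theta> f)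
  case (Suc k)
  show ?case unfolding has_leading_coeff.simps
  proof
    fix h
    have "has_leading_coeff k (real (Suc k) * real h * \<theta>) (\<lambda>n. f (n + h) - f n)"
      using Suc.prems by (simp only: has_leading_coeff.simps)
    from Suc.IH[OF this]
    show "has_leading_coeff k (real (Suc k) * real h * \<theta>) (\<lambda>n. f (n + h + s) - f (n + s))"
      by (simp add: add_ac)
  qed
qed simp

text \<open>Inverse form of Weyl's inequality: \<open>X\<close> bounds the reciprocal of the
  normalised sum, and only powers of \<open>X\<close> are lost. The sum may be shorter than the
  normalising length \<open>M\<close>, since differencing shortens it from \<open>L\<close> to
  \<open>L - h\<close>.\<close>

definition weyl_bound :: "nat \<Rightarrow> nat \<Rightarrow> bool" where
  "weyl_bound k c \<longleftrightarrow> (\<forall>X \<theta> f L M. X \<ge> 2 \<longrightarrow> has_leading_coeff k \<theta> f \<longrightarrow> L \<le> M \<longrightarrow>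
     X ^ c \<le> real M \<longrightarrow> real M \<le> X * cmod (\<Sum>n<L. expi (f n)) \<longrightarrow>
     (\<exists>q::nat. 1 \<le> q \<and> real q \<le> X ^ c \<and> dist_int (real q * \<theta>) \<le> X ^ c / real M ^ k))"

text \<open>A geometric sum with ratio \<open>expi \<theta>\<close> is at most the reciprocal of
  \<open>dist_int \<theta>\<close>, so a large sum forces \<open>\<theta>\<close> itself near an
  integer and \<open>q = 1\<close> works.\<close>

lemma weyl_bound_linear: "weyl_bound 1 1"
  unfolding weyl_bound_def
proof (intro allI impI)
  fix X \<theta> :: real and f and L M :: nat
  assume X: "2 \<le> X" and f: "has_leading_coeff 1 \<theta> f" and XM: "X ^ 1 \<le> real M"
    and large: "real M \<le> X * cmod (\<Sum>n<L. expi (f n))"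
  define s where "s = (\<Sum>n<L. expi \<theta> ^ n)"
  have "f n = f 0 + real n * \<theta>" for n
    using f by (simp add: algebra_simps) (metis add_0 add.commute diff_add_cancel mult.commute)
  then have "(\<Sum>n<L. expi (f n)) = (\<Sum>n<L. expi (f 0) * expi \<theta> ^ n)"
    by (metis expi_add expi_of_nat_mult)
  then have "cmod (\<Sum>n<L. expi (f n)) = cmod s"
    by (simp add: s_def norm_mult flip: sum_distrib_left)
  then have M: "real M \<le> X * cmod s" using large by simp
  have "(expi \<theta> - 1) * s = expi \<theta> ^ L - 1"
    unfolding s_def by (simp add: power_diff_1_eq)
  then have "cmod (expi \<theta> - 1) * cmod s \<le> 2"
    by (metis norm_mult norm_triangle_ineq4 norm_power norm_expi norm_one power_one one_add_one)
  moreover have "2 * dist_int \<theta> * cmod s \<le> cmod (expi \<theta> - 1) * cmod s"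
    using norm_expi_minus_1 by (intro mult_right_mono) auto
  ultimately have "dist_int \<theta> * cmod s \<le> 1" by linarith
  then have "X * (dist_int \<theta> * cmod s) \<le> X * 1"
    using X by (intro mult_left_mono) auto
  moreover have "dist_int \<theta> * real M \<le> dist_int \<theta> * (X * cmod s)"
    using M dist_int_nonneg by (intro mult_left_mono) auto
  ultimately have "dist_int \<theta> * real M \<le> X" by (simp add: mult_ac)
  then have "dist_int (real 1 * \<theta>) \<le> X ^ 1 / real M ^ 1"
    using X XM by (simp add: field_simps)
  then show "\<exists>q::nat. 1 \<le> q \<and> real q \<le> X ^ 1 \<and> dist_int (real q * \<theta>) \<le> X ^ 1 / real M ^ 1"
    using X by (intro exI[of _ 1]) auto
qed

text \<open>Differencing makes the leading coefficient \<open>(k + 1) h \<theta>\<close> close to a rational with small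
  denominator for a positive proportion of the shifts \<open>h\<close>; the denominator may be taken the same for
  many \<open>h\<close>, and \<open>recurrence_of_dense_set\<close> then removes \<open>h\<close>. Unlike the classical argument, this
  avoids the divisor bound, so that only powers of \<open>X\<close> are lost.\<close>

lemma weyl_bound_Suc:
  assumes IH: "weyl_bound k c" and k: "k \<ge> 1"
  shows "weyl_bound (Suc k) (15 * (c + 1) + k + 10)"
  unfolding weyl_bound_def
proof (intro allI impI)
  fix X \<theta> :: real and f and L M :: nat
  \<comment> \<open>The exponent covers \<open>7 + 15 * (c + 1)\<close> for the distance,
    \<open>3 + k + 10 * (c + 1)\<close> for the denominator and \<open>6 + 10 * (c + 1)\<close> for
    the lower bound on \<open>M\<close>.\<close>
  define c' where "c' = 15 * (c + 1) + k + 10"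
  assume X: "2 \<le> X" and f: "has_leading_coeff (Suc k) \<theta> f" and LM: "L \<le> M"
    and XM': "X ^ (15 * (c + 1) + k + 10) \<le> real M"
    and large: "real M \<le> X * cmod (\<Sum>n<L. expi (f n))"
  have XM: "X ^ c' \<le> real M" using XM' by (simp add: c'_def)
  have Xpow: "X ^ i \<le> real M" if "i \<le> c'" for i
    using power_increasing[OF that, of X] X XM by linarith
  have two_pow: "2 ^ i \<le> X ^ i" for i
    using X by (intro power_mono) auto
  have "0 < X ^ c'" using X by (intro zero_less_power) linarith
  then have "M > 0" using XM by (cases M) auto
  define T where "T h = (\<Sum>n<L - h. expi (f (n + h) - f n))" for h
  have TM: "cmod (T h) \<le> real M" for h
    using norm_sum[of "\<lambda>n. expi (f (n + h) - f n)" "{..<L - h}"] LM by (simp add: T_def)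
  \<comment> \<open>With threshold \<open>X ^ 5\<close> the shifts outside \<open>H\<close>
    contribute, after multiplication by \<open>X ^ 2\<close> and division by \<open>M\<close>, at
    most \<open>2 * M / X ^ 3 \<le> M / 4\<close>, as \<open>X \<ge> 2\<close>.\<close>
  define H where "H = {h \<in> {1..<L}. real M \<le> X ^ 5 * cmod (T h)}"
  have "finite H" by (simp add: H_def)
  have cardH: "real M \<le> X ^ 5 * real (card H)"
  proof -
    have "(cmod (\<Sum>n<L. expi (f n)))\<^sup>2 = real L + 2 * Re (\<Sum>h\<in>{1..<L}. T h)"
      using norm_sum_square[of "\<lambda>n. expi (f n)" L] by (simp add: T_def expi_diff)
    also have "\<dots> \<le> real M + 2 * (\<Sum>h\<in>{1..<L}. cmod (T h))"
      using LM complex_Re_le_cmod[of "\<Sum>h\<in>{1..<L}. T h"] norm_sum[of T "{1..<L}"] by simp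
    finally have vdc: "(cmod (\<Sum>n<L. expi (f n)))\<^sup>2 \<le> real M + 2 * (\<Sum>h\<in>{1..<L}. cmod (T h))" .
    have "(\<Sum>h\<in>{1..<L}. cmod (T h)) = (\<Sum>h\<in>H. cmod (T h)) + (\<Sum>h\<in>{1..<L} - H. cmod (T h))"
      by (subst sum.subset_diff[of H]) (auto simp: H_def)
    also have "(\<Sum>h\<in>H. cmod (T h)) \<le> real (card H) * real M"
      using sum_bounded_above[of H "\<lambda>h. cmod (T h)" "real M"] TM by simp
    also have "(\<Sum>h\<in>{1..<L} - H. cmod (T h)) \<le> real (card ({1..<L} - H)) * (real M / X ^ 5)"
      using X by (intro sum_bounded_above) (auto simp: H_def field_simps)
    also have "\<dots> \<le> real M * (real M / X ^ 5)"
    proof (intro mult_right_mono)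
      have "card ({1..<L} - H) \<le> card {1..<L}" by (intro card_mono) auto
      then show "real (card ({1..<L} - H)) \<le> real M" using LM by simp
    qed (use X in auto)
    finally have "X\<^sup>2 * (cmod (\<Sum>n<L. expi (f n)))\<^sup>2
        \<le> X\<^sup>2 * (real M + 2 * (real (card H) * real M + real M * (real M / X ^ 5)))"
      using vdc by (intro mult_left_mono) auto
    moreover have "(real M)\<^sup>2 \<le> X\<^sup>2 * (cmod (\<Sum>n<L. expi (f n)))\<^sup>2"
      using large power_mono[of "real M" _ 2] by (fastforce simp: power_mult_distrib)
    ultimately have "(real M)\<^sup>2 \<le> real M * (X\<^sup>2 + 2 * X\<^sup>2 * real (card H) + 2 * X\<^sup>2 * real M / X ^ 5)"
      by (simp add: algebra_simps)
    then have "real M \<le> X\<^sup>2 + 2 * X\<^sup>2 * real (card H) + 2 * X\<^sup>2 * real M / X ^ 5"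
      using \<open>M > 0\<close> by (simp add: power2_eq_square)
    moreover have "2 * X\<^sup>2 * real M / X ^ 5 \<le> real M / 4"
    proof -
      have "2 * X\<^sup>2 * real M / X ^ 5 = 2 * real M / X ^ 3"
        using X by (simp add: field_simps power_numeral_reduce)
      also have "\<dots> \<le> 2 * real M / 2 ^ 3"
        using two_pow[of 3] X by (intro divide_left_mono) auto
      finally show ?thesis by simp
    qed
    moreover have "X\<^sup>2 \<le> real M / 4"
    proof -
      have "2\<^sup>2 * X\<^sup>2 \<le> X\<^sup>2 * X\<^sup>2" using two_pow[of 2] by (intro mult_right_mono) auto
      also have "\<dots> \<le> real M" using Xpow[of 4] by (simp add: c'_def flip: power_add)
      finally show ?thesis by simp
    qed
    ultimately have "real M \<le> 2 ^ 2 * X\<^sup>2 * real (card H)" by simp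
    also have "\<dots> \<le> X ^ 2 * X\<^sup>2 * real (card H)"
      using two_pow[of 2] by (intro mult_right_mono) auto
    also have "\<dots> \<le> X ^ 5 * real (card H)"
      using X power_increasing[of 4 5 X] by (intro mult_right_mono) (auto simp flip: power_add)
    finally show ?thesis .
  qed
  \<comment> \<open>\<open>Z\<close> bounds the denominators that the induction hypothesis gives at
    \<open>X ^ 5\<close>; \<open>Y = X ^ 5 * Z\<close> bounds the inverse density of the shifts
    sharing one denominator.\<close>
  define Z where "Z = X ^ (5 * c)"
  define Y where "Y = X ^ (5 * (c + 1))"
  have YZ: "Y = X ^ 5 * Z" by (simp add: Y_def Z_def power_add)
  have Z1: "Z \<ge> 1" "Y \<ge> 1" "Z \<le> Y" using X by (auto simp: Z_def Y_def intro!: power_increasing)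
  have "\<exists>q::nat. 1 \<le> q \<and> real q \<le> Z \<and> dist_int (real q * (real (Suc k) * real h * \<theta>)) \<le> Z / real M ^ k"
    if "h \<in> H" for h
  proof -
    have "X ^ 5 \<ge> 2" using X self_le_power[of X 5] by simp
    moreover have "has_leading_coeff k (real (Suc k) * real h * \<theta>) (\<lambda>n. f (n + h) - f n)"
      using f by (simp only: has_leading_coeff.simps)
    moreover have "L - h \<le> M" "(X ^ 5) ^ c \<le> real M" "real M \<le> X ^ 5 * cmod (T h)"
      using LM that Xpow[of "5 * c"] by (auto simp: H_def c'_def simp flip: power_mult)
    ultimately have "\<exists>q::nat. 1 \<le> q \<and> real q \<le> (X ^ 5) ^ c \<and>
        dist_int (real q * (real (Suc k) * real h * \<theta>)) \<le> (X ^ 5) ^ c / real M ^ k"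
      using IH unfolding weyl_bound_def T_def by blast
    then show ?thesis by (simp add: Z_def power_mult)
  qed
  then obtain qf where qf: "\<And>h. h \<in> H \<Longrightarrow> 1 \<le> qf h \<and> real (qf h) \<le> Z \<and>
      dist_int (real (qf h) * (real (Suc k) * real h * \<theta>)) \<le> Z / real M ^ k"
    by metis
  define B where "B = {1..nat \<lfloor>Z\<rfloor>}"
  have cardB: "real (card B) \<le> Z" using Z1 by (simp add: B_def)
  have "B \<noteq> {}" using Z1 by (simp add: B_def le_nat_iff)
  moreover have "qf ` H \<subseteq> B" using qf by (auto simp: B_def le_nat_floor)
  ultimately obtain q where q: "q \<in> B" "card H \<le> card B * card {h \<in> H. qf h = q}"
    using large_fibre[of H B qf] \<open>finite H\<close> by (auto simp: B_def)
  define S where "S = {h \<in> H. qf h = q}"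
  have S: "S \<subseteq> {..<M}" using LM by (auto simp: S_def H_def)
  have "real (card H) \<le> Z * real (card S)"
    using q(2) cardB mult_right_mono[OF cardB, of "real (card S)"]
    by (simp add: S_def flip: of_nat_mult)
  then have "X ^ 5 * real (card H) \<le> X ^ 5 * (Z * real (card S))"
    using X by (intro mult_left_mono) auto
  then have cardS: "real M \<le> Y * real (card S)"
    using cardH by (simp add: YZ mult.assoc)
  define \<theta>' where "\<theta>' = real q * real (Suc k) * \<theta>"
  define \<epsilon> where "\<epsilon> = Z / real M ^ k"
  have near: "dist_int (real h * \<theta>') \<le> \<epsilon>" if "h \<in> S" for h
    using qf[of h] that by (simp add: S_def \<theta>'_def \<epsilon>_def mult_ac)
  have YM: "X ^ 6 * Y\<^sup>2 \<le> real M"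
    using Xpow[of "6 + 5 * (c + 1) * 2"]
    by (simp only: Y_def flip: power_mult power_add) (simp add: c'_def)
  have YM': "64 * Y\<^sup>2 \<le> real M"
    using YM mult_right_mono[OF two_pow[of 6], of "Y\<^sup>2"] by simp
  have YYM: "16 * Y \<le> real M"
    using YM' Z1 self_le_power[of Y 2] by simp
  \<comment> \<open>A window proportional to \<open>M / Y\<close> is short enough for
    \<open>8 * \<epsilon> * W \<le> 1\<close>, and long enough that dividing by it turns
    \<open>M ^ k\<close> into \<open>M ^ Suc k\<close>.\<close>
  define W where "W = nat \<lfloor>real M / (8 * Y)\<rfloor>"
  have W_le: "real W \<le> real M / (8 * Y)"
    using Z1 by (simp add: W_def)
  have "real W \<ge> real M / (8 * Y) - 1"
    using Z1 by (simp add: W_def)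
  moreover have "1 \<le> real M / (16 * Y)" using YYM Z1 by (simp add: field_simps)
  ultimately have W_ge: "real M / (16 * Y) \<le> real W"
    using Z1 by (simp add: field_simps)
  have "4 * Y \<le> real M / (16 * Y)"
    using YM' Z1 by (simp add: field_simps power2_eq_square)
  then have W4: "4 * Y \<le> real W" using W_ge by linarith
  then have "W > 0" using Z1 by (cases W) auto
  have "real M / (8 * Y) \<le> real M / 1" using Z1 by (intro divide_left_mono) auto
  then have "real W \<le> real M" using W_le by linarith
  then have WM: "W \<le> M" by simp
  have "8 * \<epsilon> * real W \<le> 8 * \<epsilon> * (real M / (8 * Y))"
    using W_le Z1 by (intro mult_left_mono) (auto simp: \<epsilon>_def)
  also have "\<dots> = (Z / Y) * (real M / real M ^ k)"
    using Z1 by (simp add: \<epsilon>_def field_simps)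
  also have "\<dots> \<le> 1 * 1"
    using Z1 \<open>M > 0\<close> k self_le_power[of "real M" k]
    by (intro mult_mono) (auto simp: field_simps)
  finally have small: "8 * \<epsilon> * real W \<le> 1" by simp
  obtain r :: nat where r: "1 \<le> r" "real r \<le> 4 * Y" "dist_int (real r * \<theta>') \<le> 8 * \<epsilon> * Y / real W"
    using recurrence_of_dense_set[OF S cardS Z1(2) WM W4 near small] by blast
  have "8 * \<epsilon> * Y / real W \<le> 8 * \<epsilon> * Y / (real M / (16 * Y))"
    using W_ge Z1 \<open>M > 0\<close> \<open>W > 0\<close> by (intro divide_left_mono mult_nonneg_nonneg mult_pos_pos) (auto simp: \<epsilon>_def)
  also have "\<dots> = 128 * (Z * Y\<^sup>2) / real M ^ Suc k"
    using Z1 by (simp add: \<epsilon>_def field_simps power2_eq_square)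
  also have "\<dots> \<le> X ^ c' / real M ^ Suc k"
  proof (intro divide_right_mono)
    have "2 ^ 7 * (Z * Y\<^sup>2) \<le> X ^ 7 * (Y * Y\<^sup>2)"
      using two_pow[of 7] Z1 X by (intro mult_mono) auto
    also have "\<dots> = X ^ (7 + 5 * (c + 1) * 3)"
      by (simp only: Y_def power_add power_mult power3_eq_cube power2_eq_square mult.assoc)
    also have "\<dots> \<le> X ^ c'" using X by (intro power_increasing) (auto simp: c'_def)
    finally show "128 * (Z * Y\<^sup>2) \<le> X ^ c'" by simp
  qed auto
  finally have "dist_int (real r * \<theta>') \<le> X ^ c' / real M ^ Suc k"
    using r(3) by linarith
  moreover have "real r * \<theta>' = real (r * q * Suc k) * \<theta>"
    by (simp only: \<theta>'_def of_nat_mult mult.assoc)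
  ultimately have dist: "dist_int (real (r * q * Suc k) * \<theta>) \<le> X ^ c' / real M ^ Suc k"
    by simp
  have "real (r * q * Suc k) \<le> X ^ c'"
  proof -
    have "real q \<le> Z" using q(1) Z1 by (auto simp: B_def le_nat_iff le_floor_iff)
    moreover have "real (Suc k) \<le> X ^ Suc k"
      using two_pow[of "Suc k"] of_nat_less_two_power[of "Suc k", where 'a = real] by linarith
    ultimately have "real r * real q * real (Suc k) \<le> (2 ^ 2 * Y) * Y * X ^ Suc k"
      using r(2) Z1 X by (intro mult_mono) auto
    also have "\<dots> \<le> (X ^ 2 * Y) * Y * X ^ Suc k"
      using two_pow[of 2] Z1 X by (intro mult_right_mono) auto
    also have "\<dots> = X ^ (2 + 5 * (c + 1) + 5 * (c + 1) + Suc k)"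
      by (simp only: Y_def power_add)
    also have "\<dots> \<le> X ^ c'" using X by (intro power_increasing) (auto simp: c'_def)
    finally show ?thesis by (simp only: of_nat_mult)
  qed
  moreover have "1 \<le> r * q * Suc k" using r(1) q(1) by (auto simp: B_def Suc_le_eq simp del: mult_Suc_right)
  ultimately show "\<exists>q::nat. 1 \<le> q \<and> real q \<le> X ^ (15 * (c + 1) + k + 10) \<and>
      dist_int (real q * \<theta>) \<le> X ^ (15 * (c + 1) + k + 10) / real M ^ Suc k"
    using dist unfolding c'_def by blast
qed

lemma weyl_bound_exists: "k \<ge> 1 \<Longrightarrow> \<exists>c. weyl_bound k c"
proof (induction k rule: dec_induct)
  case base
  then show ?case using weyl_bound_linear by blast
next
  case (step k)
  then show ?case using weyl_bound_Suc by blast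
qed

section \<open>Determinants of integer matrices\<close>

lemma abs_det_le:
  fixes A :: "int mat" and m :: int
  assumes A: "A \<in> carrier_mat d d" and bound: "\<And>i j. i < d \<Longrightarrow> j < d \<Longrightarrow> \<bar>A $$ (i, j)\<bar> \<le> m"
  shows "\<bar>det A\<bar> \<le> fact d * m ^ d"
proof -
  have "\<bar>det A\<bar> = \<bar>\<Sum>p | p permutes {0..<d}. signof p * (\<Prod>i = 0..<d. A $$ (i, p i))\<bar>"
    using A by (simp add: det_def)
  also have "\<dots> \<le> (\<Sum>p | p permutes {0..<d}. \<bar>signof p * (\<Prod>i = 0..<d. A $$ (i, p i))\<bar>)"
    by (rule sum_abs)
  also have "\<dots> \<le> (\<Sum>p | p permutes {0..<d}. m ^ d)"
  proof (rule sum_mono)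
    fix p assume "p \<in> {p. p permutes {0..<d}}"
    then have "p i < d" if "i < d" for i
      using that permutes_in_image[of p "{0..<d}" i] by simp
    then have "(\<Prod>i = 0..<d. \<bar>A $$ (i, p i)\<bar>) \<le> (\<Prod>i = 0..<d. m)"
      using bound by (intro prod_mono) auto
    then show "\<bar>signof p * (\<Prod>i = 0..<d. A $$ (i, p i))\<bar> \<le> m ^ d"
      by (simp add: abs_mult abs_prod sign_def)
  qed
  also have "\<dots> = fact d * m ^ d"
    using card_permutations[of "{0..<d}" d] by simp
  finally show ?thesis .
qed

text \<open>Cramer's rule with the denominator cleared, so that integer matrices stay integral: the
  replaced determinants are the entries of \<open>adj_mat A\<close> applied to \<open>h\<close>, and
  \<open>A * adj_mat A\<close> is \<open>det A\<close> times the identity.\<close>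

lemma det_replace_col_expansion:
  fixes A :: "'a :: comm_ring_1 mat"
  assumes A: "A \<in> carrier_mat d d" and h: "h \<in> carrier_vec d" and j: "j < d"
  shows "(\<Sum>i<d. det (replace_col A h i) * A $$ (j, i)) = det A * h $ j"
proof -
  have col: "det (replace_col A h i) = (adj_mat A *\<^sub>v h) $ i" if i: "i < d" for i
  proof -
    have R: "replace_col A h i \<in> carrier_mat d d"
      using A by (simp add: replace_col_def)
    have "mat_delete (replace_col A h i) r i = mat_delete A r i" if "r < d" for r
      using A that i by (intro eq_matI) (auto simp: mat_delete_def replace_col_def)
    then have "det (replace_col A h i) = (\<Sum>r<d. h $ r * cofactor A r i)"
      using A i by (subst laplace_expansion_column[OF R i])
        (auto simp: cofactor_def replace_col_def intro!: sum.cong)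
    also have "\<dots> = (adj_mat A *\<^sub>v h) $ i"
      using A h i by (auto simp: adj_mat_def scalar_prod_def atLeast0LessThan mult.commute intro!: sum.cong)
    finally show ?thesis .
  qed
  have "(\<Sum>i<d. det (replace_col A h i) * A $$ (j, i)) = (A *\<^sub>v (adj_mat A *\<^sub>v h)) $ j"
    using A h j adj_mat(1)[OF A] col
    by (auto simp: scalar_prod_def atLeast0LessThan mult.commute intro!: sum.cong)
  also have "A *\<^sub>v (adj_mat A *\<^sub>v h) = (A * adj_mat A) *\<^sub>v h"
    using A h adj_mat(1)[OF A] by (simp add: assoc_mult_mat_vec)
  also have "\<dots> = det A \<cdot>\<^sub>v (1\<^sub>m d *\<^sub>v h)"
    unfolding adj_mat(2)[OF A] using h by auto
  finally show ?thesis using h j by simp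
qed

section \<open>A nonnegative kernel on the torus\<close>

text \<open>These are the Fourier coefficients of \<open>cos (pi * x) ^ (2 * m)\<close>: index
  \<open>s\<close> belongs to the frequency \<open>s - m\<close>, and the shift lets
  \<open>freqs\<close> use natural numbers.\<close>

definition binom_weight :: "nat \<Rightarrow> nat \<Rightarrow> real" where
  "binom_weight m s = real ((2 * m) choose s) / 4 ^ m"

lemma binom_weight_nonneg: "binom_weight m s \<ge> 0"
  by (simp add: binom_weight_def)

lemma sum_binom_weight: "(\<Sum>s\<le>2 * m. binom_weight m s) = 1"
proof -
  have "(\<Sum>s\<le>2 * m. real ((2 * m) choose s)) = real (2 ^ (2 * m))"
    by (simp only: choose_row_sum flip: of_nat_sum)
  then show ?thesis
    by (simp add: binom_weight_def power_mult flip: sum_divide_distrib)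
qed

lemma central_binom_weight: "m \<ge> 1 \<Longrightarrow> 1 / (2 * real m) \<le> binom_weight m m"
  using central_binomial_lower_bound[of m] by (simp add: binom_weight_def field_simps)

lemma cos_power_expansion:
  "complex_of_real (cos (pi * x) ^ (2 * m))
    = (\<Sum>s\<le>2 * m. of_real (binom_weight m s) * expi (of_int (int s - int m) * x))"
proof -
  have "complex_of_real (cos (pi * x)) = (expi (x / 2) + expi (- (x / 2))) / 2"
    by (simp add: expi_def complex_eq_iff)
  then have "complex_of_real (cos (pi * x) ^ (2 * m)) = (expi (x / 2) + expi (- (x / 2))) ^ (2 * m) / 4 ^ m"
    by (simp only: of_real_power power_divide power_mult) simp
  also have "(expi (x / 2) + expi (- (x / 2))) ^ (2 * m)
      = (\<Sum>s\<le>2 * m. of_nat ((2 * m) choose s) * (expi (x / 2) ^ s * expi (- (x / 2)) ^ (2 * m - s)))"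
    by (simp add: binomial_ring mult.assoc)
  also have "\<dots> = (\<Sum>s\<le>2 * m. of_nat ((2 * m) choose s) * expi (of_int (int s - int m) * x))"
  proof (intro sum.cong refl)
    fix s assume "s \<in> {..2 * m}"
    then have "real s * (x / 2) + real (2 * m - s) * (- (x / 2)) = of_int (int s - int m) * x"
      by (simp add: of_nat_diff field_simps)
    then have "expi (x / 2) ^ s * expi (- (x / 2)) ^ (2 * m - s) = expi (of_int (int s - int m) * x)"
      by (metis expi_add expi_of_nat_mult)
    then show "of_nat ((2 * m) choose s) * (expi (x / 2) ^ s * expi (- (x / 2)) ^ (2 * m - s))
        = of_nat ((2 * m) choose s) * expi (of_int (int s - int m) * x)" by simp
  qed
  finally show ?thesis
    by (simp add: binom_weight_def sum_divide_distrib)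
qed

lemma expi_sum: "expi (\<Sum>i\<in>I. f i) = (\<Prod>i\<in>I. expi (f i))"
  by (induction I rule: infinite_finite_induct) (auto simp: expi_add)

abbreviation freqs :: "nat \<Rightarrow> nat \<Rightarrow> (nat \<Rightarrow> nat) set" where
  "freqs d m \<equiv> PiE {..<d} (\<lambda>_. {..2 * m})"

lemma prod_cos_expansion:
  "complex_of_real (\<Prod>j<d. cos (pi * x j) ^ (2 * m))
    = (\<Sum>g\<in>freqs d m. of_real (\<Prod>j<d. binom_weight m (g j)) *
        expi (\<Sum>j<d. of_int (int (g j) - int m) * x j))"
proof -
  have "complex_of_real (\<Prod>j<d. cos (pi * x j) ^ (2 * m))
      = (\<Prod>j<d. \<Sum>s\<le>2 * m. of_real (binom_weight m s) * expi (of_int (int s - int m) * x j))"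
    unfolding of_real_prod cos_power_expansion ..
  also have "\<dots> = (\<Sum>g\<in>freqs d m.
      \<Prod>j<d. of_real (binom_weight m (g j)) * expi (of_int (int (g j) - int m) * x j))"
    by (rule prod_sum_PiE) auto
  finally show ?thesis by (simp only: prod.distrib expi_sum of_real_prod)
qed

text \<open>A factor at distance \<open>r\<close> from the integers is at most
  \<open>exp (- m * r ^ 2)\<close> and all factors are at most 1, so one coordinate farther than
  \<open>\<epsilon>\<close> already pushes the product below \<open>1 / X\<close>.\<close>

lemma dist_int_le_of_prod_cos:
  fixes x :: "nat \<Rightarrow> real" and d m :: nat
  assumes prod: "1 / X \<le> (\<Prod>j<d. cos (pi * x j) ^ (2 * m))" and "X > 0"
    and ln: "ln X \<le> real m * \<epsilon>\<^sup>2" and m: "m \<ge> 1" and "\<epsilon> > 0" and j: "j < d"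
  shows "dist_int (x j) \<le> \<epsilon>"
proof -
  have cos_le: "cos (pi * t) ^ (2 * m) \<le> exp (- (real m * (dist_int t)\<^sup>2))" for t
  proof -
    have "(cos (pi * t))\<^sup>2 = 1 - \<bar>sin (pi * t)\<bar>\<^sup>2" by (simp add: cos_squared_eq)
    also have "\<dots> \<le> 1 - (dist_int t)\<^sup>2"
      using power_mono[OF abs_sin_ge_dist_int[of t] dist_int_nonneg, of 2] by simp
    also have "\<dots> \<le> exp (- (dist_int t)\<^sup>2)"
      using exp_ge_add_one_self[of "- (dist_int t)\<^sup>2"] by simp
    finally have "((cos (pi * t))\<^sup>2) ^ m \<le> exp (- (dist_int t)\<^sup>2) ^ m"
      by (intro power_mono) auto
    then show ?thesis by (simp add: power_mult flip: exp_of_nat_mult)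
  qed
  have "(\<Prod>i<d. cos (pi * x i) ^ (2 * m)) = cos (pi * x j) ^ (2 * m) * (\<Prod>i\<in>{..<d} - {j}. cos (pi * x i) ^ (2 * m))"
    using j by (subst prod.remove[of _ j]) auto
  also have "\<dots> \<le> cos (pi * x j) ^ (2 * m) * 1"
    by (intro mult_left_mono prod_le_1) (auto simp: power_mult power_le_one abs_square_le_1)
  finally have "1 / X \<le> exp (- (real m * (dist_int (x j))\<^sup>2))"
    using prod cos_le[of "x j"] by linarith
  then have "exp (real m * (dist_int (x j))\<^sup>2) \<le> X"
    using \<open>X > 0\<close> by (simp add: exp_minus field_simps)
  then have "real m * (dist_int (x j))\<^sup>2 \<le> real m * \<epsilon>\<^sup>2"
    using ln ln_ge_iff[OF \<open>X > 0\<close>] order_trans by blast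
  then have "(dist_int (x j))\<^sup>2 \<le> \<epsilon>\<^sup>2" using m by simp
  then show ?thesis by (rule power2_le_imp_le) (use \<open>\<epsilon> > 0\<close> in simp)
qed

text \<open>The zero frequency alone contributes at least \<open>2 M / X\<close> to the sum of the kernel over the
  points; the other frequencies can decrease this by at most \<open>M / X\<close>.\<close>

lemma large_kernel_value:
  fixes x :: "nat \<Rightarrow> nat \<Rightarrow> real" and d m M :: nat
  defines "X \<equiv> 2 * (2 * real m) ^ d"
  assumes m: "m \<ge> 1" and M: "M \<ge> 1"
    and freq: "\<And>g. g \<in> freqs d m \<Longrightarrow>
      - (real M / X) \<le> Re (\<Sum>n<M. expi (\<Sum>j<d. of_int (int (g j) - int m) * x n j))"
  shows "\<exists>n<M. 1 / X \<le> (\<Prod>j<d. cos (pi * x n j) ^ (2 * m))"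
proof (rule ccontr)
  assume none: "\<not> ?thesis"
  define w where "w g = (\<Prod>j<d. binom_weight m (g j))" for g :: "nat \<Rightarrow> nat"
  define R where "R g = Re (\<Sum>n<M. expi (\<Sum>j<d. of_int (int (g j) - int m) * x n j))" for g
  define z where "z = (\<lambda>j\<in>{..<d}. m)"
  have fin: "finite (freqs d m)" by (intro finite_PiE) auto
  have z: "z \<in> freqs d m" by (auto simp: z_def)
  have w0: "w g \<ge> 0" for g by (simp add: w_def prod_nonneg binom_weight_nonneg)
  have "X > 0" using m by (simp add: X_def)
  have "(\<Sum>g\<in>freqs d m. w g) = (\<Prod>j<d. \<Sum>s\<le>2 * m. binom_weight m s)"
    unfolding w_def by (rule prod_sum_PiE[symmetric]) auto
  then have w1: "(\<Sum>g\<in>freqs d m. w g) = 1" by (simp add: sum_binom_weight)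
  have "(\<Prod>j<d. 1 / (2 * real m)) \<le> w z"
    unfolding w_def using central_binom_weight[OF m] by (intro prod_mono) (auto simp: z_def)
  then have wz: "2 / X \<le> w z" using m by (simp add: X_def power_divide field_simps)
  have Rz: "R z = real M" by (simp add: R_def z_def)
  have Re_mult: "Re (complex_of_real a * u) = a * Re u" for a u by simp
  have "complex_of_real (\<Sum>n<M. \<Prod>j<d. cos (pi * x n j) ^ (2 * m))
      = (\<Sum>g\<in>freqs d m. of_real (w g) * (\<Sum>n<M. expi (\<Sum>j<d. of_int (int (g j) - int m) * x n j)))"
    unfolding of_real_sum prod_cos_expansion w_def sum_distrib_left by (rule sum.swap)
  then have "Re (complex_of_real (\<Sum>n<M. \<Prod>j<d. cos (pi * x n j) ^ (2 * m)))
      = Re (\<Sum>g\<in>freqs d m. of_real (w g) * (\<Sum>n<M. expi (\<Sum>j<d. of_int (int (g j) - int m) * x n j)))"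
    by (rule arg_cong)
  then have "(\<Sum>n<M. \<Prod>j<d. cos (pi * x n j) ^ (2 * m)) = (\<Sum>g\<in>freqs d m. w g * R g)"
    by (simp only: Re_complex_of_real Re_sum R_def Re_mult)
  also have "\<dots> = w z * R z + (\<Sum>g\<in>freqs d m - {z}. w g * R g)"
    using fin z by (rule sum.remove)
  also have "\<dots> \<ge> w z * real M + (\<Sum>g\<in>freqs d m - {z}. w g * - (real M / X))"
    unfolding Rz using freq w0 by (intro add_left_mono sum_mono mult_left_mono) (auto simp: R_def)
  finally have "w z * real M + (\<Sum>g\<in>freqs d m - {z}. w g) * - (real M / X)
      \<le> (\<Sum>n<M. \<Prod>j<d. cos (pi * x n j) ^ (2 * m))"
    by (simp only: sum_distrib_right)
  moreover have "(\<Sum>g\<in>freqs d m - {z}. w g) \<le> 1"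
    using sum_mono2[of "freqs d m" "freqs d m - {z}" w] fin w0 w1 by simp
  then have "(\<Sum>g\<in>freqs d m - {z}. w g) * (real M / X) \<le> 1 * (real M / X)"
    using \<open>X > 0\<close> by (intro mult_right_mono) auto
  moreover have "2 / X * real M \<le> w z * real M"
    using wz by (intro mult_right_mono) auto
  ultimately have "real M / X \<le> (\<Sum>n<M. \<Prod>j<d. cos (pi * x n j) ^ (2 * m))"
    by simp
  also have "\<dots> < (\<Sum>n<M. 1 / X)"
    using none M by (intro sum_strict_mono) (auto simp: not_le lessThan_empty_iff)
  finally show False by simp
qed

lemma Re_expi_nonneg:
  assumes "dist_int t \<le> 1 / 4"
  shows "Re (expi t) \<ge> 0"
proof -
  obtain p :: int where p: "dist_int t = \<bar>t - of_int p\<bar>"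
    by (meson dist_int_attained)
  have "2 * pi * (t - of_int p) \<le> 2 * pi * (1 / 4)" "2 * pi * - (1 / 4) \<le> 2 * pi * (t - of_int p)"
    using assms unfolding p abs_le_iff by (intro mult_left_mono; simp)+
  then have "cos (2 * pi * (t - of_int p)) \<ge> 0"
    by (intro cos_ge_zero) auto
  moreover have "cos (2 * pi * (t - of_int p)) = cos (2 * pi * t)"
    by (simp add: right_diff_distrib cos_diff)
  ultimately show ?thesis by (simp add: expi_def)
qed

section \<open>Increasing the rank of the resonant frequencies\<close>

text \<open>As the Cramer coefficients outside \<open>I\<close> vanish, \<open>det A * h\<close> is
  an integer combination of the columns in \<open>I\<close> with coefficients at most
  \<open>E\<close>. The triangle inequality transfers near-integrality from these columns to
  \<open>h\<close>.\<close>

lemma dist_int_of_combination: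
  fixes A :: "int mat" and b :: "nat \<Rightarrow> real" and h :: "nat \<Rightarrow> int" and E :: nat
  assumes A: "A \<in> carrier_mat d d" and I: "I \<subseteq> {..<d}"
    and zero: "\<And>i. i < d \<Longrightarrow> i \<notin> I \<Longrightarrow> det (replace_col A (vec d h) i) = 0"
    and E: "\<And>i. i < d \<Longrightarrow> \<bar>det (replace_col A (vec d h) i)\<bar> \<le> int E"
    and near: "\<And>i. i \<in> I \<Longrightarrow> dist_int (\<Sum>j<d. of_int (A $$ (j, i)) * b j) \<le> t" and "t \<ge> 0"
  shows "dist_int (of_int \<bar>det A\<bar> * (\<Sum>j<d. of_int (h j) * b j)) \<le> real d * real E * t"
proof -
  define c where "c i = det (replace_col A (vec d h) i)" for i
  define v where "v i = (\<Sum>j<d. of_int (A $$ (j, i)) * b j)" for i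
  have expand: "det A * h j = (\<Sum>i\<in>I. c i * A $$ (j, i))" if "j < d" for j
  proof -
    have "det A * h j = (\<Sum>i<d. c i * A $$ (j, i))"
      using det_replace_col_expansion[OF A, of "vec d h" j] that by (simp add: c_def)
    also have "\<dots> = (\<Sum>i\<in>I. c i * A $$ (j, i))"
      using I zero by (intro sum.mono_neutral_right) (auto simp: c_def)
    finally show ?thesis .
  qed
  have "of_int (det A) * (\<Sum>j<d. of_int (h j) * b j) = (\<Sum>j<d. of_int (det A * h j) * b j)"
    by (simp add: sum_distrib_left mult.assoc)
  also have "\<dots> = (\<Sum>j<d. \<Sum>i\<in>I. of_int (c i) * (of_int (A $$ (j, i)) * b j))"
    by (intro sum.cong refl) (simp add: expand sum_distrib_right mult.assoc)
  also have "\<dots> = (\<Sum>i\<in>I. of_int (c i) * v i)"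
    unfolding v_def sum_distrib_left by (rule sum.swap)
  finally have eq: "of_int (det A) * (\<Sum>j<d. of_int (h j) * b j) = (\<Sum>i\<in>I. of_int (c i) * v i)" .
  have "dist_int (of_int \<bar>det A\<bar> * (\<Sum>j<d. of_int (h j) * b j))
      = dist_int (of_int (sgn (det A)) * (\<Sum>i\<in>I. of_int (c i) * v i))"
    unfolding abs_sgn[of "det A"] eq[symmetric] by (simp add: mult_ac)
  also have "\<dots> \<le> \<bar>of_int (sgn (det A))\<bar> * dist_int (\<Sum>i\<in>I. of_int (c i) * v i)"
    by (rule dist_int_mult_int)
  also have "\<dots> \<le> 1 * (\<Sum>i\<in>I. dist_int (of_int (c i) * v i))"
    by (intro mult_mono dist_int_sum) (auto simp: sgn_if dist_int_nonneg)
  also have "\<dots> \<le> (\<Sum>i\<in>I. real E * t)"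
    unfolding mult_1
  proof (rule sum_mono)
    fix i assume i: "i \<in> I"
    have "dist_int (of_int (c i) * v i) \<le> \<bar>of_int (c i)\<bar> * dist_int (v i)"
      by (rule dist_int_mult_int)
    also have "\<dots> \<le> real E * t"
    proof (intro mult_mono)
      show "\<bar>real_of_int (c i)\<bar> \<le> real E"
        using E[of i] I i unfolding c_def by (metis lessThan_iff of_int_abs of_int_le_iff of_int_of_nat_eq subsetD)
    qed (use near[OF i] in \<open>auto simp: v_def dist_int_nonneg\<close>)
    finally show "dist_int (of_int (c i) * v i) \<le> real E * t" .
  qed
  also have "\<dots> = real (card I) * (real E * t)" by simp
  also have "\<dots> \<le> real d * (real E * t)"
    using card_mono[OF _ I] \<open>t \<ge> 0\<close> by (intro mult_right_mono) auto
  finally show ?thesis by (simp add: mult.assoc)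
qed

text \<open>The columns of \<open>A\<close> with index in \<open>I\<close> are frequencies that are nearly resonant with
  \<open>Q ^ k\<close> times \<open>\<alpha>\<close>. Frequencies in their span are harmless after multiplying \<open>Q\<close> by the determinant;
  a frequency outside their span with a large Weyl sum can be exchanged, by Cramer's rule, for a
  column not in \<open>I\<close>. This happens at most \<open>d\<close> times.\<close>

lemma simultaneous_recurrence:
  fixes \<alpha> :: "nat \<Rightarrow> real" and k c d m :: nat and \<epsilon> :: real
  defines "E \<equiv> fact d * m ^ d" and "X \<equiv> 2 * (2 * m) ^ d"
  defines "G \<equiv> 4 * d * E ^ k * X ^ c"
  assumes weyl: "weyl_bound k c" and k: "k \<ge> 1" and d: "d \<ge> 1" and m: "m \<ge> 1"
    and \<epsilon>: "\<epsilon> > 0" and ln: "ln (real X) \<le> real m * \<epsilon>\<^sup>2"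
  shows "\<exists>n\<ge>1. n \<le> G ^ (d + 2) \<and> (\<forall>j<d. dist_int (real n ^ k * \<alpha> j) \<le> \<epsilon>)"
proof -
  \<comment> \<open>\<open>E\<close> bounds determinants with entries at most \<open>m\<close>, and
    \<open>1 / X\<close> is the threshold for a large normalised Weyl sum. \<open>G\<close>, the
    price of one round, covers the determinant \<open>D \<le> E\<close>, the denominator
    \<open>q \<le> X ^ c\<close> and the factor \<open>4 * d * E ^ k\<close>.\<close>
  have E1: "E \<ge> 1" and X1: "X \<ge> 2" using m by (auto simp: E_def X_def)
  have X_real: "real X = 2 * (2 * real m) ^ d" by (simp add: X_def)
  have E_k: "E \<le> E ^ k" using k E1 by (intro self_le_power) auto
  have XG: "X ^ c \<le> G" and EXG: "E * X ^ c \<le> G" and EG: "E \<le> G"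
  proof -
    have "1 * X ^ c \<le> 4 * d * E ^ k * X ^ c"
      by (intro mult_right_mono) (use d E1 in auto)
    then show "X ^ c \<le> G" by (simp add: G_def)
    have "1 * E * X ^ c \<le> 4 * d * E ^ k * X ^ c"
      by (intro mult_right_mono mult_mono) (use d E_k in auto)
    then show *: "E * X ^ c \<le> G" by (simp add: G_def)
    have "E * 1 \<le> E * X ^ c" using X1 by (intro mult_left_mono) auto
    then show "E \<le> G" using * by linarith
  qed
  have G1: "G \<ge> 1" using EG E1 by simp
  \<comment> \<open>With this tolerance a frequency in the span, after losing \<open>d\<close> and
    \<open>E ^ k\<close>, is within \<open>1 / (4 * M ^ k)\<close> of an integer, so its phases stay
    within a quarter turn of 0 for all points up to \<open>M\<close>.\<close>
  define \<tau> where "\<tau> = 1 / (4 * real d * real E ^ k)"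
  have \<tau>0: "\<tau> > 0" using d E1 by (simp add: \<tau>_def)
  define w :: "nat \<Rightarrow> int mat \<Rightarrow> nat \<Rightarrow> real"
    where "w Q A i = real Q ^ k * (\<Sum>j<d. of_int (A $$ (j, i)) * \<alpha> j)" for Q A i
  \<comment> \<open>The columns in \<open>I\<close> are the resonances found so far; the others are
    placeholders keeping \<open>det A \<noteq> 0\<close>. Each round moves one factor
    \<open>G\<close> from the remaining length \<open>G ^ (d - card I + 1)\<close> to the bound on
    \<open>Q\<close>.\<close>
  have main: "\<exists>n\<ge>1. n \<le> G ^ (d + 2) \<and> (\<forall>j<d. dist_int (real n ^ k * \<alpha> j) \<le> \<epsilon>)"
    if A: "A \<in> carrier_mat d d" and Am: "\<And>i j. i < d \<Longrightarrow> j < d \<Longrightarrow> \<bar>A $$ (i, j)\<bar> \<le> int m"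
      and det: "det A \<noteq> 0" and I: "I \<subseteq> {..<d}" and Q: "1 \<le> Q" "Q \<le> G ^ card I"
      and near: "\<And>i. i \<in> I \<Longrightarrow> dist_int (w Q A i) \<le> \<tau> / real (G ^ (d - card I + 1)) ^ k"
    for A :: "int mat" and I Q
    using that
  proof (induction "d - card I" arbitrary: A I Q rule: less_induct)
    case less
    note A = less.prems(1) and Am = less.prems(2) and det = less.prems(3) and I = less.prems(4)
      and Q = less.prems(5,6) and near = less.prems(7)
    have "finite I" using I finite_subset by blast
    have card_le: "card I \<le> d" using card_mono[OF _ I] by simp
    define D where "D = nat \<bar>det A\<bar>"
    have D_real: "real D = of_int \<bar>det A\<bar>" by (simp add: D_def)
    have D1: "D \<ge> 1" using det by (simp add: D_def)
    have DE: "D \<le> E"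
      using abs_det_le[OF A, of "int m"] Am by (simp add: D_def E_def nat_le_iff)
    define M where "M = G ^ (d - card I + 1)"
    have M1: "M \<ge> 1" using G1 by (simp add: M_def)
    have GM: "G \<le> M" unfolding M_def using G1 by (intro self_le_power) auto
    define \<beta> where "\<beta> j = real (Q * D) ^ k * \<alpha> j" for j
    define fr :: "(nat \<Rightarrow> nat) \<Rightarrow> nat \<Rightarrow> int" where "fr g j = int (g j) - int m" for g j
    define \<theta> where "\<theta> g = (\<Sum>j<d. of_int (fr g j) * \<beta> j)" for g
    define cf where "cf g i = det (replace_col A (vec d (fr g)) i)" for g i
    have \<theta>_eq: "\<theta> g = real (Q * D) ^ k * (\<Sum>j<d. of_int (fr g j) * \<alpha> j)" for g
      by (simp add: \<theta>_def \<beta>_def sum_distrib_left mult_ac)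
    have phase: "(\<Sum>j<d. of_int (fr g j) * (real n ^ k * \<beta> j)) = real n ^ k * \<theta> g" for g n
      by (simp add: \<theta>_def sum_distrib_left mult_ac)
    have fr_le: "\<bar>fr g j\<bar> \<le> int m" if "g \<in> freqs d m" "j < d" for g j
    proof -
      have "g j \<le> 2 * m" using that by auto
      then show ?thesis by (auto simp: fr_def)
    qed
    have R: "replace_col A (vec d (fr g)) i \<in> carrier_mat d d" for g i
      using A by (simp add: replace_col_def)
    have R_idx: "replace_col A (vec d (fr g)) i $$ (a, b) = (if b = i then fr g a else A $$ (a, b))"
      if "a < d" "b < d" for g i a b
      using A that by (simp add: replace_col_def)
    have Rm: "\<bar>replace_col A (vec d (fr g)) i $$ (a, b)\<bar> \<le> int m"
      if "g \<in> freqs d m" "a < d" "b < d" for g i a b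
      using that fr_le Am by (simp add: R_idx)
    have cf_le: "\<bar>cf g i\<bar> \<le> int E" if "g \<in> freqs d m" for g i
      using abs_det_le[OF R Rm[OF that]] by (simp add: cf_def E_def)
    show ?case
    \<comment> \<open>The points are \<open>Suc n\<close>, as 0 would be a trivial recurrence. A
      nonzero Cramer coefficient off \<open>I\<close> means that the frequency lies outside the span
      of the columns in \<open>I\<close>.\<close>
    proof (cases "\<exists>g\<in>freqs d m. \<exists>i<d. i \<notin> I \<and> cf g i \<noteq> 0 \<and>
        real M \<le> real X * cmod (\<Sum>n<M. expi (real (Suc n) ^ k * \<theta> g))")
      case False
      have "- (real M / (2 * (2 * real m) ^ d))
          \<le> Re (\<Sum>n<M. expi (\<Sum>j<d. of_int (int (g j) - int m) * (real (Suc n) ^ k * \<beta> j)))"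
        if g: "g \<in> freqs d m" for g
      proof (cases "\<exists>i<d. i \<notin> I \<and> cf g i \<noteq> 0")
        case True
        then have "real X * cmod (\<Sum>n<M. expi (real (Suc n) ^ k * \<theta> g)) < real M"
          using False g by (auto simp: not_le)
        then have "cmod (\<Sum>n<M. expi (real (Suc n) ^ k * \<theta> g)) \<le> real M / real X"
          using X1 by (simp add: field_simps)
        then have "- (real M / real X) \<le> Re (\<Sum>n<M. expi (real (Suc n) ^ k * \<theta> g))"
          using abs_Re_le_cmod[of "\<Sum>n<M. expi (real (Suc n) ^ k * \<theta> g)"] by linarith
        then show ?thesis unfolding phase[unfolded fr_def] X_real .
      next
        \<comment> \<open>The frequency lies in the span: its sum may be large, but all terms have
          nonnegative real part.\<close>
        case False
        have "dist_int (of_int \<bar>det A\<bar> * (\<Sum>j<d. of_int (fr g j) * (real Q ^ k * \<alpha> j)))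
            \<le> real d * real E * (\<tau> / real M ^ k)"
        proof (rule dist_int_of_combination[OF A I])
          show "det (replace_col A (vec d (fr g)) i) = 0" if "i < d" "i \<notin> I" for i
            using False that by (auto simp: cf_def)
          show "\<bar>det (replace_col A (vec d (fr g)) i)\<bar> \<le> int E" for i
            using cf_le[OF g, of i] by (simp add: cf_def)
          show "dist_int (\<Sum>j<d. of_int (A $$ (j, i)) * (real Q ^ k * \<alpha> j)) \<le> \<tau> / real M ^ k"
            if "i \<in> I" for i
            using near[OF that] by (simp add: w_def M_def sum_distrib_left mult_ac)
        qed (use \<tau>0 in auto)
        then have dD: "dist_int (real D * (\<Sum>j<d. of_int (fr g j) * (real Q ^ k * \<alpha> j)))
            \<le> real d * real E * (\<tau> / real M ^ k)"
          by (simp only: D_real)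
        \<comment> \<open>One factor \<open>D\<close> clears the Cramer denominator; the other
          \<open>k - 1\<close> only multiply the error.\<close>
        have "\<theta> g = real (D ^ (k - 1)) * (real D * (\<Sum>j<d. of_int (fr g j) * (real Q ^ k * \<alpha> j)))"
        proof -
          have "real D ^ k = real D ^ (k - 1) * real D"
            using k by (simp flip: power_Suc2)
          moreover have "(\<Sum>j<d. of_int (fr g j) * (real Q ^ k * \<alpha> j)) = real Q ^ k * (\<Sum>j<d. of_int (fr g j) * \<alpha> j)"
            by (simp add: sum_distrib_left mult_ac)
          ultimately show ?thesis
            by (simp add: \<theta>_eq power_mult_distrib)
        qed
        then have "dist_int (\<theta> g) \<le> real (D ^ (k - 1)) * (real d * real E * (\<tau> / real M ^ k))"
          using order_trans[OF dist_int_mult_nat mult_left_mono[OF dD, of "real (D ^ (k - 1))"]] by simp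
        also have "\<dots> \<le> real (E ^ (k - 1)) * (real d * real E * (\<tau> / real M ^ k))"
          using DE \<tau>0 by (intro mult_right_mono) (auto intro: power_mono)
        also have "\<dots> = (real E ^ (k - 1) * real E) * real d * \<tau> / real M ^ k"
          by simp
        also have "real E ^ (k - 1) * real E = real E ^ k"
          using k by (simp flip: power_Suc2)
        also have "real E ^ k * real d * \<tau> / real M ^ k = 1 / 4 / real M ^ k"
          using d E1 by (simp add: \<tau>_def)
        finally have \<theta>_small: "dist_int (\<theta> g) \<le> 1 / 4 / real M ^ k" .
        have "Re (expi (real (Suc n) ^ k * \<theta> g)) \<ge> 0" if n: "n < M" for n
        proof (rule Re_expi_nonneg)
          have "dist_int (real (Suc n ^ k) * \<theta> g) \<le> real (Suc n ^ k) * dist_int (\<theta> g)"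
            by (rule dist_int_mult_nat)
          also have "\<dots> \<le> real (M ^ k) * (1 / 4 / real M ^ k)"
            using n \<theta>_small by (intro mult_mono of_nat_mono power_mono) (auto simp: dist_int_nonneg)
          also have "\<dots> = 1 / 4" using M1 by simp
          finally show "dist_int (real (Suc n) ^ k * \<theta> g) \<le> 1 / 4" by simp
        qed
        then have "0 \<le> Re (\<Sum>n<M. expi (real (Suc n) ^ k * \<theta> g))"
          unfolding Re_sum by (intro sum_nonneg) auto
        moreover have "0 \<le> real M / (2 * (2 * real m) ^ d)" by simp
        ultimately show ?thesis
          unfolding phase[unfolded fr_def] by linarith
      qed
      then obtain n where n: "n < M"
          "1 / (2 * (2 * real m) ^ d) \<le> (\<Prod>j<d. cos (pi * (real (Suc n) ^ k * \<beta> j)) ^ (2 * m))"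
        using large_kernel_value[OF m M1, of d "\<lambda>n j. real (Suc n) ^ k * \<beta> j"] by blast
      have close: "dist_int (real (Suc n) ^ k * \<beta> j) \<le> \<epsilon>" if "j < d" for j
        by (rule dist_int_le_of_prod_cos[OF n(2) _ _ m \<epsilon> that]) (use m ln in \<open>auto simp: X_def\<close>)
      \<comment> \<open>The three factors are at most \<open>G ^ card I\<close>, \<open>G\<close>
        and \<open>M\<close>, with exponents adding up to \<open>d + 2\<close>.\<close>
      define N where "N = Q * D * Suc n"
      have "N \<le> G ^ card I * G * G ^ (d - card I + 1)"
        unfolding N_def using Q DE EG n(1) M_def by (intro mult_le_mono) auto
      also have "\<dots> = G ^ (card I + 1 + (d - card I + 1))"
        by (simp add: power_add)
      also have "card I + 1 + (d - card I + 1) = d + 2" using card_le by simp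
      finally have "N \<le> G ^ (d + 2)" .
      moreover have "N \<ge> 1" using Q D1 by (auto simp: N_def Suc_le_eq simp del: mult_Suc_right)
      moreover have "real N ^ k * \<alpha> j = real (Suc n) ^ k * \<beta> j" for j
        by (simp only: N_def \<beta>_def of_nat_mult power_mult_distrib mult_ac)
      ultimately show ?thesis using close by auto
    next
      case True
      then obtain g i where g: "g \<in> freqs d m" and i: "i < d" "i \<notin> I" "cf g i \<noteq> 0"
        and large: "real M \<le> real X * cmod (\<Sum>n<M. expi (real (Suc n) ^ k * \<theta> g))"
        by blast
      have lead: "has_leading_coeff k (\<theta> g) (\<lambda>n. real (Suc n) ^ k * \<theta> g)"
        using has_leading_coeff_shift[OF has_leading_coeff_monomial[of k "\<theta> g"], of 1] by simp
      have XM: "real X ^ c \<le> real M" using XG GM by (metis le_trans of_nat_le_iff of_nat_power)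
      have "real X \<ge> 2" using X1 by simp
      then obtain q :: nat where q: "1 \<le> q" "real q \<le> real X ^ c" "dist_int (real q * \<theta> g) \<le> real X ^ c / real M ^ k"
        using weyl[unfolded weyl_bound_def] lead XM large by blast
      have qX: "q \<le> X ^ c" using q(2) by (metis of_nat_le_iff of_nat_power)
      \<comment> \<open>The exchanged matrix has determinant \<open>cf g i\<close>, hence nonzero,
        and the columns in \<open>I\<close> survive because \<open>i \<notin> I\<close>.\<close>
      define A' where "A' = replace_col A (vec d (fr g)) i"
      define I' where "I' = insert i I"
      define Q' where "Q' = Q * (D * q)"
      have card': "card I' = Suc (card I)" using i \<open>finite I\<close> by (simp add: I'_def)
      have I': "I' \<subseteq> {..<d}" using I i by (auto simp: I'_def)
      have card_less: "card I < d" using card_mono[OF _ I'] card' by simp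
      define M' where "M' = G ^ (d - card I' + 1)"
      have MM': "real M = real G * real M'"
        using card_less unfolding M_def M'_def card' by (simp add: Suc_diff_Suc flip: power_Suc)
      have M'1: "M' \<ge> 1" using G1 by (simp add: M'_def)
      have Dq: "D * q \<le> G" using mult_le_mono[OF DE qX] EXG by simp
      \<comment> \<open>Shortening the range by one factor \<open>G\<close> raises the tolerance by
        \<open>G ^ k\<close>, which pays for multiplying the old phases by
        \<open>(D * q) ^ k\<close>.\<close>
      have scale: "real G ^ k * \<tau> / real M ^ k = \<tau> / real M' ^ k"
        using G1 M'1 by (simp add: MM' power_mult_distrib)
      show ?thesis
      proof (rule less.hyps[of I' A' Q'])
        show "d - card I' < d - card I" using card' card_less by simp
        show "A' \<in> carrier_mat d d" by (simp add: A'_def R)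
        show "\<bar>A' $$ (a, b)\<bar> \<le> int m" if "a < d" "b < d" for a b
          using Rm[OF g that] by (simp add: A'_def)
        show "det A' \<noteq> 0" using i by (simp add: A'_def cf_def)
        show "I' \<subseteq> {..<d}" by fact
        show "1 \<le> Q'" using Q q D1 by (simp add: Q'_def)
        show "Q' \<le> G ^ card I'"
          unfolding Q'_def card' power_Suc2 using Q Dq by (intro mult_le_mono) auto
        show "dist_int (w Q' A' i') \<le> \<tau> / real (G ^ (d - card I' + 1)) ^ k" if i': "i' \<in> I'" for i'
        proof (cases "i' = i")
          case True
          have "real (q ^ (k - 1)) * (real q * \<theta> g) = real q ^ k * \<theta> g"
            using k by (simp add: mult.assoc[symmetric] flip: power_Suc2)
          also have "\<dots> = w Q' A' i'"
            using i by (simp add: w_def \<theta>_eq Q'_def True A'_def R_idx power_mult_distrib mult_ac)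
          finally have "dist_int (w Q' A' i') \<le> real (q ^ (k - 1)) * dist_int (real q * \<theta> g)"
            using dist_int_mult_nat[of "q ^ (k - 1)" "real q * \<theta> g"] by simp
          also have "\<dots> \<le> real ((X ^ c) ^ (k - 1)) * (real X ^ c / real M ^ k)"
            using qX q(3) by (intro mult_mono of_nat_mono power_mono) (auto simp: dist_int_nonneg)
          also have "\<dots> = real (X ^ c) ^ k / real M ^ k"
            using k by (simp flip: power_Suc2)
          also have "\<dots> \<le> real G ^ k * \<tau> / real M ^ k"
          proof (intro divide_right_mono)
            \<comment> \<open>The factor \<open>u = 1 / \<tau>\<close> built into \<open>G\<close>
              enters here: \<open>u \<le> u ^ k\<close> leaves room for
              \<open>\<tau>\<close>.\<close>
            define u where "u = 4 * d * E ^ k"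
            have u1: "u \<ge> 1" using d E1 by (simp add: u_def)
            then have "real u \<le> real u ^ k" using k by (intro self_le_power) auto
            then have "real u * real (X ^ c) ^ k \<le> real u ^ k * real (X ^ c) ^ k"
              by (intro mult_right_mono) auto
            also have "\<dots> = real G ^ k" by (simp add: G_def u_def power_mult_distrib)
            finally have "real u * real (X ^ c) ^ k \<le> real G ^ k" .
            then have "real (X ^ c) ^ k \<le> real G ^ k / real u"
              using u1 by (simp add: pos_le_divide_eq mult.commute)
            also have "\<dots> = real G ^ k * \<tau>" by (simp add: \<tau>_def u_def)
            finally show "real (X ^ c) ^ k \<le> real G ^ k * \<tau>" .
          qed simp
          finally show ?thesis using scale by (simp add: M'_def)
        next
          case False
          then have i'I: "i' \<in> I" "i' < d" using i' I by (auto simp: I'_def)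
          have "w Q' A' i' = real ((D * q) ^ k) * w Q A i'"
            using False i'I by (simp add: w_def Q'_def A'_def R_idx power_mult_distrib mult_ac)
          then have "dist_int (w Q' A' i') \<le> real ((D * q) ^ k) * dist_int (w Q A i')"
            by (simp only: dist_int_mult_nat)
          also have "\<dots> \<le> real (G ^ k) * (\<tau> / real M ^ k)"
            using near[OF i'I(1)] Dq
            by (intro mult_mono of_nat_mono power_mono) (auto simp: M_def dist_int_nonneg)
          finally show ?thesis using scale by (simp add: M'_def)
        qed
      qed
    qed
  qed
  show ?thesis
  \<comment> \<open>Start with no resonances; the identity matrix supplies independent placeholder
    columns.\<close>
  proof (rule main[of "1\<^sub>m d" "{}" 1])
    show "\<bar>1\<^sub>m d $$ (i, j)\<bar> \<le> int m" if "i < d" "j < d" for i j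
      using that m by simp
  qed auto
qed

section \<open>Choice of the kernel degree and final estimates\<close>

lemma kernel_degree_sufficient:
  fixes d m :: nat and \<epsilon> :: real
  assumes d: "d \<ge> 1" and m: "m \<ge> 1" and "\<epsilon> > 0" and large: "8 * (real d)\<^sup>2 \<le> real m * \<epsilon> ^ 4"
  shows "ln (real (2 * (2 * m) ^ d)) \<le> real m * \<epsilon>\<^sup>2"
proof -
  \<comment> \<open>Applying \<open>ln s \<le> s - 1\<close> to the square root of
    \<open>2 * m\<close> bounds the logarithm by \<open>2 * d * s\<close>; comparing squares turns
    the goal into the condition \<open>large\<close>.\<close>
  define s where "s = sqrt (2 * real m)"
  have s: "s > 0" "s\<^sup>2 = 2 * real m" using m by (auto simp: s_def)
  have "ln (real (2 * (2 * m) ^ d)) = ln 2 + real d * ln (s\<^sup>2)"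
    using m by (simp add: ln_mult ln_realpow s(2) distrib_left)
  also have "ln (s\<^sup>2) = 2 * ln s" using s(1) by (simp add: ln_realpow)
  also have "ln 2 + real d * (2 * ln s) \<le> real d * 1 + real d * (2 * (s - 1))"
    using ln_le_minus_one[of s] ln_le_minus_one[of "2::real"] s(1) d
    by (intro add_mono mult_left_mono) auto
  also have "\<dots> \<le> 2 * real d * s" using d by (simp add: algebra_simps)
  also have "\<dots> \<le> real m * \<epsilon>\<^sup>2"
  proof (rule power2_le_imp_le)
    have "(2 * real d * s)\<^sup>2 = real m * (8 * (real d)\<^sup>2)"
      by (simp add: power_mult_distrib s(2))
    also have "\<dots> \<le> real m * (real m * \<epsilon> ^ 4)"
      using large by (intro mult_left_mono) auto
    also have "\<dots> = (real m * \<epsilon>\<^sup>2)\<^sup>2"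
      by (simp add: power2_eq_square power4_eq_xxxx mult_ac)
    finally show "(2 * real d * s)\<^sup>2 \<le> (real m * \<epsilon>\<^sup>2)\<^sup>2" .
  qed simp
  finally show ?thesis .
qed

text \<open>Here \<open>ln m\<close> is of order at most \<open>d * L\<close>, so
  \<open>d * ln m\<close> and \<open>ln (fact d)\<close> are of order at most
  \<open>d ^ 2 * L\<close>; the \<open>k\<close> determinant factors and the \<open>c\<close>
  factors of the threshold each contribute one such term.\<close>

lemma ln_length_bound:
  fixes d m k c :: nat and L :: real
  assumes d: "d \<ge> 1" and m: "m \<ge> 1" and L: "L \<ge> 1" and mL: "real m \<le> 9 * (real d)\<^sup>2 * exp (4 * L)"
  shows "ln (real (4 * d * (fact d * m ^ d) ^ k * (2 * (2 * m) ^ d) ^ c))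
    \<le> (4 + 12 * real k + 12 * real c) * (real d)\<^sup>2 * L"
proof -
  define u where "u = (real d)\<^sup>2 * L"
  have dd: "real d \<le> (real d)\<^sup>2" using d by (intro self_le_power) auto
  have dL: "1 \<le> real d * L" "real d \<le> real d * L" "L \<le> real d * L"
    using d L mult_mono[of 1 "real d" 1 L] by auto
  have "(real d)\<^sup>2 * 1 \<le> u" unfolding u_def using L by (intro mult_left_mono) auto
  then have u: "1 \<le> u" "real d \<le> u" "(real d)\<^sup>2 \<le> u"
    using dd d by linarith+
  have lnd: "ln (real d) \<le> real d" using d ln_le_minus_one[of "real d"] by simp
  have "(2::real) ^ 5 \<le> exp 1 ^ 5"
    using exp_ge_add_one_self[of 1] by (intro power_mono) auto
  then have "18 \<le> exp (5::real)" by (simp flip: exp_of_nat_mult)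
  then have "18 * ((real d)\<^sup>2 * exp (4 * L)) \<le> exp 5 * ((real d)\<^sup>2 * exp (4 * L))"
    by (intro mult_right_mono) auto
  then have "2 * real m \<le> exp 5 * ((real d)\<^sup>2 * exp (4 * L))" using mL by simp
  then have "ln (2 * real m) \<le> ln (exp 5 * ((real d)\<^sup>2 * exp (4 * L)))"
    using m d by (subst ln_le_cancel_iff) auto
  also have "\<dots> = 5 + (2 * ln (real d) + 4 * L)"
    using d by (simp add: ln_mult ln_realpow)
  also have "\<dots> \<le> 11 * (real d * L)" using lnd dL by linarith
  finally have ln2m: "ln (2 * real m) \<le> 11 * (real d * L)" .
  then have "real d * ln (2 * real m) \<le> real d * (11 * (real d * L))"
    by (intro mult_left_mono) auto
  then have d_ln2m: "real d * ln (2 * real m) \<le> 11 * u"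
    by (simp add: u_def power2_eq_square mult_ac)
  have "ln (2 * real m) = ln 2 + ln (real m)" using m by (simp add: ln_mult)
  then have "ln (real m) \<le> ln (2 * real m)" by simp
  then have d_lnm: "real d * ln (real m) \<le> 11 * u"
    using d_ln2m mult_left_mono[of "ln (real m)" "ln (2 * real m)" "real d"] by simp
  have "ln (fact d :: real) \<le> ln (real d ^ d)"
  proof (subst ln_le_cancel_iff)
    show "(fact d :: real) \<le> real d ^ d"
      using fact_le_power[of d, where 'a = real] by simp
  qed (use d in auto)
  also have "\<dots> = real d * ln (real d)" using d by (simp add: ln_realpow)
  also have "\<dots> \<le> real d * real d" using lnd by (intro mult_left_mono) auto
  also have "\<dots> \<le> u" using u by (simp add: power2_eq_square)
  finally have "ln (fact d * real m ^ d) \<le> 12 * u"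
    using m d_lnm by (simp add: ln_mult ln_realpow)
  then have lnE: "real k * ln (fact d * real m ^ d) \<le> real k * (12 * u)"
    by (intro mult_left_mono) auto
  have "ln (2 * (2 * real m) ^ d) = ln 2 + ln ((2 * real m) ^ d)"
    using m by (intro ln_mult_pos) auto
  also have "ln ((2 * real m) ^ d) = real d * ln (2 * real m)"
    by (rule ln_realpow)
  also have "ln 2 + real d * ln (2 * real m) \<le> 12 * u" using d_ln2m u ln_le_minus_one[of "2::real"] by simp
  finally have lnX: "real c * ln (2 * (2 * real m) ^ d) \<le> real c * (12 * u)"
    by (intro mult_left_mono) auto
  have "ln (4 * real d) = ln 4 + ln (real d)" using d by (simp add: ln_mult)
  then have ln4d: "ln (4 * real d) \<le> 4 * u"
    using lnd u ln_le_minus_one[of "4::real"] by simp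
  have "ln (real (4 * d * (fact d * m ^ d) ^ k * (2 * (2 * m) ^ d) ^ c))
      = ln (4 * real d * (fact d * real m ^ d) ^ k * (2 * (2 * real m) ^ d) ^ c)"
    by simp
  also have "\<dots> = ln (4 * real d * (fact d * real m ^ d) ^ k) + ln ((2 * (2 * real m) ^ d) ^ c)"
    using d m by (intro ln_mult_pos) auto
  also have "ln (4 * real d * (fact d * real m ^ d) ^ k) = ln (4 * real d) + ln ((fact d * real m ^ d) ^ k)"
    using d m by (intro ln_mult_pos) auto
  also have "ln ((fact d * real m ^ d) ^ k) = real k * ln (fact d * real m ^ d)"
    by (rule ln_realpow)
  also have "ln ((2 * (2 * real m) ^ d) ^ c) = real c * ln (2 * (2 * real m) ^ d)"
    by (rule ln_realpow)
  also have "ln (4 * real d) + real k * ln (fact d * real m ^ d) + real c * ln (2 * (2 * real m) ^ d)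
      \<le> 4 * u + real k * (12 * u) + real c * (12 * u)"
    using ln4d lnE lnX by linarith
  also have "\<dots> = (4 + 12 * real k + 12 * real c) * (real d)\<^sup>2 * L"
    by (simp add: u_def algebra_simps)
  finally show ?thesis .
qed

theorem theorem2:
  fixes k :: nat
  assumes "k \<ge> 1"
  shows "\<exists>C A :: real. C \<ge> 1 \<and> A > 0 \<and>
    (\<forall>(d::nat) (\<alpha>::nat \<Rightarrow> real) (N::nat). d \<ge> 1 \<longrightarrow> N \<ge> 1 \<longrightarrow>
       (\<exists>n::nat. 1 \<le> n \<and> n \<le> N \<and>
          (\<forall>j\<in>{1..d}. dist_int (real n ^ k * \<alpha> j)
             \<le> A * exp (- (1 / (C * real d ^ 5)) * ln (real N) powr (1 / C)))))"
proof -
  obtain c where c: "weyl_bound k c" using weyl_bound_exists[OF assms] by blast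
  \<comment> \<open>The factor 3 comes from \<open>d + 2 \<le> 3 * d\<close>.\<close>
  define C :: real where "C = 3 * (4 + 12 * real k + 12 * real c)"
  have C: "C \<ge> 1" by (simp add: C_def)
  have "\<exists>n::nat. 1 \<le> n \<and> n \<le> N \<and> (\<forall>j\<in>{1..d}. dist_int (real n ^ k * \<alpha> j)
      \<le> exp 1 * exp (- (1 / (C * real d ^ 5)) * ln (real N) powr (1 / C)))"
    if d: "d \<ge> 1" and N: "N \<ge> 1" for d N :: nat and \<alpha> :: "nat \<Rightarrow> real"
  proof -
    define y where "y = ln (real N) powr (1 / C)"
    define L where "L = 1 / (C * real d ^ 5) * y"
    have y: "y = C * real d ^ 5 * L" using C d by (simp add: L_def)
    show ?thesis
    \<comment> \<open>For \<open>L < 1\<close> the constant \<open>exp 1\<close> makes the bound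
      exceed 1/2, so \<open>n = 1\<close> works.\<close>
    proof (cases "L < 1")
      case True
      have "dist_int (real 1 ^ k * \<alpha> j) \<le> exp 1 * exp (- L)" for j
      proof -
        have "dist_int (real 1 ^ k * \<alpha> j) \<le> 1 / 2" by (rule dist_int_le_half)
        also have "\<dots> \<le> exp (1 - L)" using True exp_ge_add_one_self[of "1 - L"] by linarith
        finally show ?thesis by (simp add: exp_diff exp_minus field_simps)
      qed
      then show ?thesis using N by (intro exI[of _ 1]) (simp add: L_def y_def)
    next
      case False
      then have L: "L \<ge> 1" by simp
      define \<epsilon> where "\<epsilon> = exp (- L)"
      define v where "v = (real d)\<^sup>2 * exp (4 * L)"
      have \<epsilon>4: "\<epsilon> ^ 4 = 1 / exp (4 * L)" by (simp add: \<epsilon>_def exp_minus field_simps flip: exp_of_nat_mult)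
      have "1 * 1 \<le> v" unfolding v_def using d L by (intro mult_mono) (auto simp: power_le_one_iff)
      then have v: "v \<ge> 1" by simp
      define m where "m = nat \<lceil>8 * v\<rceil>"
      have m_ge: "8 * v \<le> real m" unfolding m_def by (rule real_nat_ceiling_ge)
      have m_le: "real m \<le> 9 * v" 
      proof -
        have "real m = of_int \<lceil>8 * v\<rceil>" using v by (simp add: m_def)
        then show ?thesis using v of_int_ceiling_le_add_one[of "8 * v"] by linarith
      qed
      have m1: "m \<ge> 1" using m_ge v by (cases m) auto
      have "8 * (real d)\<^sup>2 = 8 * v * \<epsilon> ^ 4" by (simp add: v_def \<epsilon>4)
      also have "\<dots> \<le> real m * \<epsilon> ^ 4" using m_ge by (intro mult_right_mono) (auto simp: \<epsilon>_def)
      finally have "ln (real (2 * (2 * m) ^ d)) \<le> real m * \<epsilon>\<^sup>2"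
        by (intro kernel_degree_sufficient d m1) (auto simp: \<epsilon>_def)
      then obtain n where n: "n \<ge> 1" "n \<le> (4 * d * (fact d * m ^ d) ^ k * (2 * (2 * m) ^ d) ^ c) ^ (d + 2)"
          "\<And>j. j < d \<Longrightarrow> dist_int (real n ^ k * \<alpha> (Suc j)) \<le> \<epsilon>"
        using simultaneous_recurrence[OF c assms d m1, of \<epsilon> "\<lambda>j. \<alpha> (Suc j)"] by (auto simp: \<epsilon>_def)
      define G where "G = 4 * d * (fact d * m ^ d) ^ k * (2 * (2 * m) ^ d) ^ c"
      have "G \<ge> 1" using d m1 by (simp add: G_def Suc_le_eq)
      then have G: "real G \<ge> 1" by simp
      have "ln (real G) \<le> (4 + 12 * real k + 12 * real c) * (real d)\<^sup>2 * L"
        unfolding G_def using m_le by (intro ln_length_bound d m1 L) (simp add: v_def)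
      then have "real (d + 2) * ln (real G) \<le> (3 * real d) * ((4 + 12 * real k + 12 * real c) * (real d)\<^sup>2 * L)"
        using d L G by (intro mult_mono) auto
      also have "\<dots> = C * real d ^ 3 * L"
        by (simp add: C_def power2_eq_square power3_eq_cube)
      also have "\<dots> \<le> y"
        unfolding y using d C L by (intro mult_right_mono mult_left_mono power_increasing) auto
      \<comment> \<open>Since \<open>y \<ge> 1\<close>, raising it to the power
        \<open>C \<ge> 1\<close> does not decrease it, and \<open>y powr C\<close> is
        \<open>ln N\<close>.\<close>
      also have "\<dots> \<le> ln (real N)"
      proof -
        have "1 \<le> C * real d ^ 5" using C d mult_mono[of 1 C 1 "real d ^ 5"] by simp
        then have "1 \<le> y" unfolding y using L mult_mono[of 1 "C * real d ^ 5" 1 L] by simp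
        then have "y powr 1 \<le> y powr C" using C by (intro powr_mono) auto
        also have "y powr C = ln (real N)"
          unfolding y_def powr_powr using C N by simp
        finally show ?thesis using \<open>1 \<le> y\<close> by simp
      qed
      finally have "real (d + 2) * ln (real G) \<le> ln (real N)" .
      moreover have "ln (real G ^ (d + 2)) = real (d + 2) * ln (real G)"
        by (rule ln_realpow)
      ultimately have "ln (real G ^ (d + 2)) \<le> ln (real N)" by linarith
      then have "real G ^ (d + 2) \<le> real N"
        using G N by (subst (asm) ln_le_cancel_iff) auto
      then have "G ^ (d + 2) \<le> N" by (metis of_nat_le_iff of_nat_power)
      then have nN: "n \<le> N" using n(2) unfolding G_def by (rule order_trans[rotated])
      have "dist_int (real n ^ k * \<alpha> j) \<le> exp 1 * exp (- L)" if "j \<in> {1..d}" for j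
      proof -
        have "dist_int (real n ^ k * \<alpha> j) \<le> 1 * \<epsilon>" using n(3)[of "j - 1"] that by (cases j) auto
        also have "\<dots> \<le> exp 1 * \<epsilon>" by (intro mult_right_mono) (auto simp: \<epsilon>_def)
        finally show ?thesis by (simp add: \<epsilon>_def)
      qed
      then show ?thesis using n(1) nN by (auto simp: L_def y_def)
    qed
  qed
  then show ?thesis using C by (intro exI[of _ C] exI[of _ "exp 1"]) auto
qed

end
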